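(* Let $k$ be a field, let $H$ be a Hopf algebra over $k$, and let $A=T(V)/(R)$ be a quadratic algebra (connected, $\mathbb{N}$-graded, locally finite-dimensional, with $V=A_1$ and $R\subseteq V\otimes V$) which is also an $H$-module algebra on which $H$ acts by degree-preserving endomorphisms, i.e. $h\rhd a\in A_i$ for all $h\in H$, $a\in A_i$, $i\in\mathbb{N}$. If $\mu\in H\otimes H$ is a counital $2$-cocycle of $H$, then the Drinfeld twist $A_\mu$ is a quadratic algebra of the form $T(V)/(R_\mu)$, where $R_\mu:=\{\mu\rhd r\mid r\in R\}\subseteq V\otimes V$.
   Context: All objects are linear over the field $k$ and $\otimes=\otimes_k$. For a Hopf algebra $H$, $\triangle$ denotes the coproduct and $\epsilon$ the counit; the action of $h\in H$ on an element $a$ of an $H$-module is written $h\rhd a$. An $H$-module algebra is an algebra $A$ that is an $H$-module such that the product $m:A\otimes A\to A$ satisfies $h\rhd m(a\otimes b)=m(\triangle(h)\rhd (a\otimes b))$ and $h\rhd 1_A=\epsilon(h)1_A$. Here and below $H\otimes H$ acts on a tensor product of two $H$-modules by $(h\otimes h')\rhd(a\otimes b)=(h\rhd a)\otimes(h'\rhd b)$; in particular $\mu\in H\otimes H$ acts on $V\otimes V$. A $2$-cocycle of $H$ is an invertible element $\mu\in H\otimes H$ with $(\mu\otimes 1)\cdot(\triangle\otimes\mathrm{id})(\mu)=(1\otimes\mu)\cdot(\mathrm{id}\otimes\triangle)(\mu)$. It is counital if $(\epsilon\otimes\mathrm{id})(\mu)=1=(\mathrm{id}\otimes\epsilon)(\mu)$.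 The Drinfeld twist of an $H$-module algebra $(A,m)$ by a counital $2$-cocycle $\mu$ is the algebra $(A_\mu,m_\mu)$ with $A_\mu=A$ as a vector space (and the same unit) and product $m_\mu(a\otimes b)=m(\mu^{-1}\rhd(a\otimes b))$. A connected $\mathbb{N}$-graded algebra is $A=\bigoplus_{i\in\mathbb{N}}A_i$ with $A_iA_j\subseteq A_{i+j}$ and $A_0=k$; it is locally finite-dimensional if each $A_i$ is finite-dimensional. Such an $A$ is quadratic if, with $V:=A_1$, there is a subspace $R\subseteq V\otimes V$ with $A=T(V)/(R)$, where $T(V)$ is the tensor algebra and $(R)$ the two-sided ideal generated by $R$. For a connected graded algebra $B$ with $B_1=V$, the equality $B=T(V)/(S)$ means that the canonical algebra homomorphism $T(V)\to B$ extending the inclusion $V=B_1\hookrightarrow B$ is surjective with kernel $(S)$. The algebra $A_\mu$ carries the grading of $A$, so $(A_\mu)_1=V$. *)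

theory Defs
  imports Complex_Main "HOL-Library.Function_Algebras"
begin

section \<open>Tensor powers and the tensor algebra of a vector space\<close>

text \<open>
  A vector space over a field \<open>'k\<close> is a type with a scalar multiplication \<open>s\<close>
  satisfying the library locale \<^locale>\<open>vector_space\<close>. Only tensor powers of one space
  are needed, so all of them are kept inside a single model of the tensor algebra
  \<open>T(W) = W\<^sup>0 \<oplus> W \<oplus> (W \<otimes> W) \<oplus> \<dots>\<close>:
  the pure tensor \<open>x1 \<otimes> \<dots> \<otimes> xn\<close> is the evaluation functional
  \<open>\<beta> \<mapsto> \<beta> [x1, \<dots>, xn]\<close> on the multilinear forms, and \<open>T(W)\<close> is the span of the pure tensors
  (in the space of all functionals, with pointwise operations). Over a field this is a tensor
  algebra: the universal property is proved below (\<open>tensor_lift\<close>, \<open>tensor_lift_unique\<close>).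
\<close>

type_synonym ('a, 'k) tensor = "('a list \<Rightarrow> 'k) \<Rightarrow> 'k"

definition tscale :: "'k::field \<Rightarrow> ('a, 'k) tensor \<Rightarrow> ('a, 'k) tensor" where
  "tscale c t = (\<lambda>\<beta>. c * t \<beta>)"

text \<open>Multilinear in each slot, separately for every length of the argument list.\<close>

definition multilinear ::
  "('k::field \<Rightarrow> 'a::ab_group_add \<Rightarrow> 'a) \<Rightarrow> ('k \<Rightarrow> 'b::ab_group_add \<Rightarrow> 'b) \<Rightarrow> ('a list \<Rightarrow> 'b) \<Rightarrow> bool" where
  "multilinear s s' f \<longleftrightarrow> (\<forall>us vs. Vector_Spaces.linear s s' (\<lambda>x. f (us @ x # vs)))"

definition tensor :: "('k::field \<Rightarrow> 'a::ab_group_add \<Rightarrow> 'a) \<Rightarrow> 'a list \<Rightarrow> ('a, 'k) tensor" where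
  "tensor s xs = (\<lambda>\<beta>. if multilinear s (*) \<beta> then \<beta> xs else 0)"

text \<open>For a subspace \<open>V\<close> of the ambient space \<open>W\<close>, the spaces \<open>T(V)\<close> and \<open>V\<^sup>\<otimes>\<^sup>n\<close> are
  identified with their images in \<open>T(W)\<close>; over a field the induced maps are injective.\<close>

definition tensor_algebra :: "('k::field \<Rightarrow> 'a::ab_group_add \<Rightarrow> 'a) \<Rightarrow> 'a set \<Rightarrow> ('a, 'k) tensor set" where
  "tensor_algebra s V = module.span tscale (tensor s ` lists V)"

definition tensor_power ::
  "('k::field \<Rightarrow> 'a::ab_group_add \<Rightarrow> 'a) \<Rightarrow> nat \<Rightarrow> 'a set \<Rightarrow> ('a, 'k) tensor set" where
  "tensor_power s n V = module.span tscale (tensor s ` {xs \<in> lists V. length xs = n})"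

text \<open>The linear map on \<open>T(W)\<close> induced by a multilinear map \<open>f\<close>. Only its values on \<open>T(W)\<close>,
  which are uniquely determined, are meaningful.\<close>

definition tensor_lift ::
  "('k::field \<Rightarrow> 'a::ab_group_add \<Rightarrow> 'a) \<Rightarrow> ('k \<Rightarrow> 'b::ab_group_add \<Rightarrow> 'b)
    \<Rightarrow> ('a list \<Rightarrow> 'b) \<Rightarrow> ('a, 'k) tensor \<Rightarrow> 'b" where
  "tensor_lift s s' f = (SOME g. Vector_Spaces.linear tscale s' g \<and> (\<forall>xs. g (tensor s xs) = f xs))"

text \<open>The linear map \<open>W \<otimes> W \<rightarrow> U\<close> induced by a bilinear map \<open>W \<times> W \<rightarrow> U\<close>.\<close>

definition bilinear_lift ::
  "('k::field \<Rightarrow> 'a::ab_group_add \<Rightarrow> 'a) \<Rightarrow> ('k \<Rightarrow> 'b::ab_group_add \<Rightarrow> 'b)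
    \<Rightarrow> ('a \<Rightarrow> 'a \<Rightarrow> 'b) \<Rightarrow> ('a, 'k) tensor \<Rightarrow> 'b" where
  "bilinear_lift s s' f = tensor_lift s s' (\<lambda>xs. case xs of [x, y] \<Rightarrow> f x y | _ \<Rightarrow> 0)"

text \<open>The product of the tensor algebra (concatenation); it also serves as the map
  \<open>W\<^sup>\<otimes>\<^sup>m \<times> W\<^sup>\<otimes>\<^sup>n \<rightarrow> W\<^sup>\<otimes>\<^sup>(\<^sup>m\<^sup>+\<^sup>n\<^sup>)\<close>, \<open>(x, y) \<mapsto> x \<otimes> y\<close>. Its unit is \<open>tensor s []\<close>.\<close>

definition tensor_concat ::
  "('k::field \<Rightarrow> 'a::ab_group_add \<Rightarrow> 'a) \<Rightarrow> ('a, 'k) tensor \<Rightarrow> ('a, 'k) tensor \<Rightarrow> ('a, 'k) tensor" where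
  "tensor_concat s x y =
    tensor_lift s tscale (\<lambda>us. tensor_lift s tscale (\<lambda>vs. tensor s (us @ vs)) y) x"

text \<open>The two-sided ideal of \<open>T(V)\<close> generated by a subset.\<close>

definition tensor_ideal ::
  "('k::field \<Rightarrow> 'a::ab_group_add \<Rightarrow> 'a) \<Rightarrow> 'a set \<Rightarrow> ('a, 'k) tensor set \<Rightarrow> bool" where
  "tensor_ideal s V I \<longleftrightarrow>
     I \<subseteq> tensor_algebra s V \<and> module.subspace tscale I \<and>
     (\<forall>x\<in>I. \<forall>y\<in>tensor_algebra s V. tensor_concat s x y \<in> I \<and> tensor_concat s y x \<in> I)"

definition generated_ideal ::
  "('k::field \<Rightarrow> 'a::ab_group_add \<Rightarrow> 'a) \<Rightarrow> 'a set \<Rightarrow> ('a, 'k) tensor set \<Rightarrow> ('a, 'k) tensor set" where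
  "generated_ideal s V R = tensor_ideal s V hull R"


section \<open>Algebras and quadratic algebras\<close>

record ('k, 'a) alg =
  scale :: "'k \<Rightarrow> 'a \<Rightarrow> 'a"
  mult :: "'a \<Rightarrow> 'a \<Rightarrow> 'a"
  unit :: 'a

definition k_algebra :: "('k::field, 'a::ab_group_add, 'm) alg_scheme \<Rightarrow> bool" where
  "k_algebra A \<longleftrightarrow>
     vector_space (scale A) \<and>
     (\<forall>a. Vector_Spaces.linear (scale A) (scale A) (\<lambda>b. mult A a b)) \<and>
     (\<forall>b. Vector_Spaces.linear (scale A) (scale A) (\<lambda>a. mult A a b)) \<and>
     (\<forall>a b c. mult A (mult A a b) c = mult A a (mult A b c)) \<and>
     (\<forall>a. mult A (unit A) a = a \<and> mult A a (unit A) = a)"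

definition connected_graded :: "('k::field, 'a::ab_group_add, 'm) alg_scheme \<Rightarrow> (nat \<Rightarrow> 'a set) \<Rightarrow> bool" where
  "connected_graded A G \<longleftrightarrow>
     (\<forall>i. module.subspace (scale A) (G i)) \<and>
     (\<forall>a. \<exists>!f. (\<forall>i. f i \<in> G i) \<and> finite {i. f i \<noteq> 0} \<and> a = (\<Sum>i | f i \<noteq> 0. f i)) \<and>
     (\<forall>i j. \<forall>a\<in>G i. \<forall>b\<in>G j. mult A a b \<in> G (i + j)) \<and>
     G 0 = range (\<lambda>c. scale A c (unit A)) \<and> unit A \<noteq> 0"

definition locally_finite_dimensional ::
  "('k::field, 'a::ab_group_add, 'm) alg_scheme \<Rightarrow> (nat \<Rightarrow> 'a set) \<Rightarrow> bool" where
  "locally_finite_dimensional A G \<longleftrightarrow> (\<forall>i. \<exists>B. finite B \<and> G i = module.span (scale A) B)"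

text \<open>\<open>\<phi>\<close> restricts to the algebra homomorphism \<open>T(V) \<rightarrow> A\<close> extending the inclusion of the
  subspace \<open>V\<close> into \<open>A\<close>; these conditions determine \<open>\<phi>\<close> on \<open>T(V)\<close>. (Linearity on the whole
  ambient type is no restriction, as linear maps extend from subspaces.)\<close>

definition canonical_hom ::
  "('k::field, 'a::ab_group_add, 'm) alg_scheme \<Rightarrow> 'a set \<Rightarrow> (('a, 'k) tensor \<Rightarrow> 'a) \<Rightarrow> bool" where
  "canonical_hom A V \<phi> \<longleftrightarrow>
     Vector_Spaces.linear tscale (scale A) \<phi> \<and>
     \<phi> (tensor (scale A) []) = unit A \<and>
     (\<forall>x\<in>tensor_algebra (scale A) V. \<forall>y\<in>tensor_algebra (scale A) V.
        \<phi> (tensor_concat (scale A) x y) = mult A (\<phi> x) (\<phi> y)) \<and>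
     (\<forall>v\<in>V. \<phi> (tensor (scale A) [v]) = v)"

text \<open>\<open>A\<close>, with the grading \<open>G\<close>, is the quadratic algebra \<open>T(V)/(R)\<close> where \<open>V = G 1\<close>.\<close>

definition quadratic_algebra ::
  "('k::field, 'a::ab_group_add, 'm) alg_scheme \<Rightarrow> (nat \<Rightarrow> 'a set) \<Rightarrow> ('a, 'k) tensor set \<Rightarrow> bool" where
  "quadratic_algebra A G R \<longleftrightarrow>
     k_algebra A \<and> connected_graded A G \<and> locally_finite_dimensional A G \<and>
     module.subspace tscale R \<and> R \<subseteq> tensor_power (scale A) 2 (G 1) \<and>
     (\<exists>\<phi>. canonical_hom A (G 1) \<phi> \<and>
        \<phi> ` tensor_algebra (scale A) (G 1) = UNIV \<and>
        {x \<in> tensor_algebra (scale A) (G 1). \<phi> x = 0} = generated_ideal (scale A) (G 1) R)"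


section \<open>Hopf algebras, module algebras, cocycles and the Drinfeld twist\<close>

record ('k, 'h) hopf_alg = "('k, 'h) alg" +
  comult :: "'h \<Rightarrow> ('h, 'k) tensor"
  counit :: "'h \<Rightarrow> 'k"
  antipode :: "'h \<Rightarrow> 'h"

text \<open>Componentwise product on each tensor power \<open>H\<^sup>\<otimes>\<^sup>n\<close>.\<close>

definition tensor_mult ::
  "('k::field, 'h::ab_group_add, 'm) alg_scheme \<Rightarrow> ('h, 'k) tensor \<Rightarrow> ('h, 'k) tensor \<Rightarrow> ('h, 'k) tensor" where
  "tensor_mult H x y =
    tensor_lift (scale H) tscale (\<lambda>us. tensor_lift (scale H) tscale
      (\<lambda>vs. if length us = length vs then tensor (scale H) (map2 (mult H) us vs) else 0) y) x"

text \<open>The maps \<open>\<triangle> \<otimes> id\<close> and \<open>id \<otimes> \<triangle>\<close> from \<open>H \<otimes> H\<close> to \<open>H \<otimes> H \<otimes> H\<close>.\<close>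

definition comult_id :: "('k::field, 'h::ab_group_add, 'm) hopf_alg_scheme \<Rightarrow> ('h, 'k) tensor \<Rightarrow> ('h, 'k) tensor" where
  "comult_id H = bilinear_lift (scale H) tscale
     (\<lambda>x y. tensor_concat (scale H) (comult H x) (tensor (scale H) [y]))"

definition id_comult :: "('k::field, 'h::ab_group_add, 'm) hopf_alg_scheme \<Rightarrow> ('h, 'k) tensor \<Rightarrow> ('h, 'k) tensor" where
  "id_comult H = bilinear_lift (scale H) tscale
     (\<lambda>x y. tensor_concat (scale H) (tensor (scale H) [x]) (comult H y))"

text \<open>The maps \<open>\<epsilon> \<otimes> id\<close> and \<open>id \<otimes> \<epsilon>\<close> on \<open>H \<otimes> H\<close>, with \<open>k \<otimes> H = H = H \<otimes> k\<close>.\<close>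

definition counit_id :: "('k::field, 'h::ab_group_add, 'm) hopf_alg_scheme \<Rightarrow> ('h, 'k) tensor \<Rightarrow> 'h" where
  "counit_id H = bilinear_lift (scale H) (scale H) (\<lambda>x y. scale H (counit H x) y)"

definition id_counit :: "('k::field, 'h::ab_group_add, 'm) hopf_alg_scheme \<Rightarrow> ('h, 'k) tensor \<Rightarrow> 'h" where
  "id_counit H = bilinear_lift (scale H) (scale H) (\<lambda>x y. scale H (counit H y) x)"

definition hopf_algebra :: "('k::field, 'h::ab_group_add, 'm) hopf_alg_scheme \<Rightarrow> bool" where
  "hopf_algebra H \<longleftrightarrow>
     k_algebra H \<and>
     \<comment> \<open>coalgebra\<close>
     Vector_Spaces.linear (scale H) tscale (comult H) \<and>
     (\<forall>h. comult H h \<in> tensor_power (scale H) 2 UNIV) \<and>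
     Vector_Spaces.linear (scale H) (*) (counit H) \<and>
     (\<forall>h. comult_id H (comult H h) = id_comult H (comult H h)) \<and>
     (\<forall>h. counit_id H (comult H h) = h \<and> id_counit H (comult H h) = h) \<and>
     \<comment> \<open>compatibility\<close>
     (\<forall>g h. comult H (mult H g h) = tensor_mult H (comult H g) (comult H h)) \<and>
     comult H (unit H) = tensor (scale H) [unit H, unit H] \<and>
     (\<forall>g h. counit H (mult H g h) = counit H g * counit H h) \<and>
     counit H (unit H) = 1 \<and>
     \<comment> \<open>antipode\<close>
     Vector_Spaces.linear (scale H) (scale H) (antipode H) \<and>
     (\<forall>h. bilinear_lift (scale H) (scale H) (\<lambda>x y. mult H (antipode H x) y) (comult H h)
            = scale H (counit H h) (unit H) \<and>
          bilinear_lift (scale H) (scale H) (\<lambda>x y. mult H x (antipode H y)) (comult H h)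
            = scale H (counit H h) (unit H))"

definition hopf_module ::
  "('k::field, 'h::ab_group_add, 'm) alg_scheme \<Rightarrow> ('k \<Rightarrow> 'a::ab_group_add \<Rightarrow> 'a) \<Rightarrow> ('h \<Rightarrow> 'a \<Rightarrow> 'a) \<Rightarrow> bool" where
  "hopf_module H s act \<longleftrightarrow>
     (\<forall>h. Vector_Spaces.linear s s (\<lambda>a. act h a)) \<and>
     (\<forall>a. Vector_Spaces.linear (scale H) s (\<lambda>h. act h a)) \<and>
     (\<forall>a. act (unit H) a = a) \<and>
     (\<forall>g h a. act (mult H g h) a = act g (act h a))"

text \<open>The action of \<open>H \<otimes> H\<close> on the tensor square of an \<open>H\<close>-module with scalar multiplication \<open>s\<close>.\<close>

definition tensor_act ::
  "('k::field, 'h::ab_group_add, 'm) alg_scheme \<Rightarrow> ('k \<Rightarrow> 'a::ab_group_add \<Rightarrow> 'a) \<Rightarrow> ('h \<Rightarrow> 'a \<Rightarrow> 'a)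
    \<Rightarrow> ('h, 'k) tensor \<Rightarrow> ('a, 'k) tensor \<Rightarrow> ('a, 'k) tensor" where
  "tensor_act H s act \<mu> t =
     bilinear_lift (scale H) tscale
       (\<lambda>g h. bilinear_lift s tscale (\<lambda>a b. tensor s [act g a, act h b]) t) \<mu>"

text \<open>The product as a linear map \<open>A \<otimes> A \<rightarrow> A\<close>.\<close>

definition mult_map :: "('k::field, 'a::ab_group_add, 'm) alg_scheme \<Rightarrow> ('a, 'k) tensor \<Rightarrow> 'a" where
  "mult_map A = bilinear_lift (scale A) (scale A) (mult A)"

definition module_algebra ::
  "('k::field, 'h::ab_group_add, 'm) hopf_alg_scheme \<Rightarrow> ('k, 'a::ab_group_add, 'n) alg_scheme
    \<Rightarrow> ('h \<Rightarrow> 'a \<Rightarrow> 'a) \<Rightarrow> bool" where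
  "module_algebra H A act \<longleftrightarrow>
     k_algebra A \<and> hopf_module H (scale A) act \<and>
     (\<forall>h a b. act h (mult A a b)
        = mult_map A (tensor_act H (scale A) act (comult H h) (tensor (scale A) [a, b]))) \<and>
     (\<forall>h. act h (unit A) = scale A (counit H h) (unit A))"

definition inverse_tensor ::
  "('k::field, 'h::ab_group_add, 'm) alg_scheme \<Rightarrow> ('h, 'k) tensor \<Rightarrow> ('h, 'k) tensor \<Rightarrow> bool" where
  "inverse_tensor H \<mu> \<nu> \<longleftrightarrow>
     \<nu> \<in> tensor_power (scale H) 2 UNIV \<and>
     tensor_mult H \<mu> \<nu> = tensor (scale H) [unit H, unit H] \<and>
     tensor_mult H \<nu> \<mu> = tensor (scale H) [unit H, unit H]"

definition two_cocycle :: "('k::field, 'h::ab_group_add, 'm) hopf_alg_scheme \<Rightarrow> ('h, 'k) tensor \<Rightarrow> bool" where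
  "two_cocycle H \<mu> \<longleftrightarrow>
     \<mu> \<in> tensor_power (scale H) 2 UNIV \<and> (\<exists>\<nu>. inverse_tensor H \<mu> \<nu>) \<and>
     tensor_mult H (tensor_concat (scale H) \<mu> (tensor (scale H) [unit H])) (comult_id H \<mu>)
       = tensor_mult H (tensor_concat (scale H) (tensor (scale H) [unit H]) \<mu>) (id_comult H \<mu>)"

definition counital :: "('k::field, 'h::ab_group_add, 'm) hopf_alg_scheme \<Rightarrow> ('h, 'k) tensor \<Rightarrow> bool" where
  "counital H \<mu> \<longleftrightarrow> counit_id H \<mu> = unit H \<and> id_counit H \<mu> = unit H"

definition drinfeld_twist ::
  "('k::field, 'h::ab_group_add, 'm) alg_scheme \<Rightarrow> ('k, 'a::ab_group_add) alg
    \<Rightarrow> ('h \<Rightarrow> 'a \<Rightarrow> 'a) \<Rightarrow> ('h, 'k) tensor \<Rightarrow> ('k, 'a) alg" where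
  "drinfeld_twist H A act \<mu> =
     A\<lparr>mult := \<lambda>a b. mult_map A
        (tensor_act H (scale A) act (THE \<nu>. inverse_tensor H \<mu> \<nu>) (tensor (scale A) [a, b]))\<rparr>"


section \<open>The universal property and values on pure tensors\<close>

lemma vector_space_tscale: "vector_space (tscale :: 'k::field \<Rightarrow> ('a, 'k) tensor \<Rightarrow> ('a, 'k) tensor)"
  by unfold_locales (auto simp: tscale_def fun_eq_iff algebra_simps)

lemma vector_space_field: "vector_space ((*) :: 'k::field \<Rightarrow> 'k \<Rightarrow> 'k)"
  by unfold_locales (auto simp: algebra_simps)

lemma linearI:
  assumes "vector_space s" "vector_space s'"
    "\<And>x y. f (x + y) = f x + f y" "\<And>c x. f (s c x) = s' c (f x)"
  shows "Vector_Spaces.linear s s' f"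
  using assms by (simp add: Vector_Spaces.linear_def module_hom_def module_hom_axioms_def
      module_iff_vector_space)

lemma linearD:
  assumes "Vector_Spaces.linear s s' f"
  shows "vector_space s" "vector_space s'" "f (x + y) = f x + f y" "f (s c x) = s' c (f x)"
proof -
  interpret Vector_Spaces.linear s s' f by fact
  show "vector_space s" "vector_space s'" "f (x + y) = f x + f y" "f (s c x) = s' c (f x)"
    by (simp_all add: add scale vs1.vector_space_axioms vs2.vector_space_axioms)
qed

lemma linear_comp:
  assumes f: "Vector_Spaces.linear s s' f" and g: "Vector_Spaces.linear s' s'' g"
  shows "Vector_Spaces.linear s s'' (\<lambda>x. g (f x))"
proof (rule linearI)
  show "g (f (x + y)) = g (f x) + g (f y)" for x y
    unfolding linearD(3)[OF f] linearD(3)[OF g] ..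
  show "g (f (s c x)) = s'' c (g (f x))" for c x
    unfolding linearD(4)[OF f] linearD(4)[OF g] ..
qed (fact linearD(1)[OF f] linearD(2)[OF g])+

lemma linear_eval: "Vector_Spaces.linear tscale (*) (\<lambda>t :: ('a, 'k::field) tensor. t \<beta>)"
  by (rule linearI[OF vector_space_tscale vector_space_field]) (auto simp: tscale_def)

lemma multilinear_comp:
  assumes "multilinear s s' f" "Vector_Spaces.linear s' s'' g"
  shows "multilinear s s'' (\<lambda>xs. g (f xs))"
  using assms(1) linear_comp[OF _ assms(2)] unfolding multilinear_def by blast

lemma multilinear_tensor:
  assumes "vector_space s"
  shows "multilinear s tscale (tensor s)"
  unfolding multilinear_def
proof (intro allI)
  fix us vs
  show "Vector_Spaces.linear s tscale (\<lambda>x. tensor s (us @ x # vs))"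
  proof (rule linearI[OF assms vector_space_tscale])
    fix x y c
    have *: "multilinear s (*) \<beta> \<Longrightarrow> Vector_Spaces.linear s (*) (\<lambda>x. \<beta> (us @ x # vs))" for \<beta>
      by (auto simp: multilinear_def)
    show "tensor s (us @ (x + y) # vs) = tensor s (us @ x # vs) + tensor s (us @ y # vs)"
      using linearD(3)[OF *] by (auto simp: tensor_def)
    show "tensor s (us @ s c x # vs) = tscale c (tensor s (us @ x # vs))"
      using linearD(4)[OF *] by (auto simp: tensor_def tscale_def)
  qed
qed

lemma functionals_separate:
  fixes s :: "'k::field \<Rightarrow> 'a::ab_group_add \<Rightarrow> 'a"
  assumes "vector_space s" "v \<noteq> 0"
  shows "\<exists>g. Vector_Spaces.linear s (*) g \<and> g v \<noteq> 0"
proof -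
  interpret vector_space_pair s "(*) :: 'k \<Rightarrow> _"
    using assms(1) vector_space_field by (simp add: vector_space_pair_def)
  have "vs1.independent {v}" using assms(2) by simp
  from linear_independent_extend[OF this, of "\<lambda>_. 1"] show ?thesis by force
qed

lemma tensor_lift_exists:
  fixes s :: "'k::field \<Rightarrow> 'a::ab_group_add \<Rightarrow> 'a" and s' :: "'k \<Rightarrow> 'b::ab_group_add \<Rightarrow> 'b"
  assumes f: "multilinear s s' f"
  shows "\<exists>g. Vector_Spaces.linear tscale s' g \<and> (\<forall>xs. g (tensor s xs) = f xs)"
proof -
  have vs': "vector_space s'"
    using f linearD(2) unfolding multilinear_def by blast
  interpret vector_space_pair "tscale :: 'k \<Rightarrow> ('a, 'k) tensor \<Rightarrow> _" s'
    using vs' vector_space_tscale by (simp add: vector_space_pair_def)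
  obtain B where B: "B \<subseteq> range (tensor s)" "vs1.independent B" "range (tensor s) \<subseteq> vs1.span B"
    using vs1.maximal_independent_subset[of "range (tensor s)"] by blast
  define r where "r b = (SOME xs. tensor s xs = b)" for b
  have r: "tensor s (r b) = b" if "b \<in> B" for b
    unfolding r_def using that B(1) by (metis (mono_tags, lifting) imageE someI_ex subsetD)
  obtain g where g: "Vector_Spaces.linear tscale s' g" "\<And>b. b \<in> B \<Longrightarrow> g b = f (r b)"
    using linear_independent_extend[OF B(2), of "\<lambda>b. f (r b)"] by blast
  have "g (tensor s xs) = f xs" for xs
  proof (rule ccontr)
    assume "g (tensor s xs) \<noteq> f xs"
    then obtain u where u: "Vector_Spaces.linear s' (*) u" "u (g (tensor s xs) - f xs) \<noteq> 0"
      using functionals_separate[OF vs', of "g (tensor s xs) - f xs"] by auto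
    interpret u: Vector_Spaces.linear s' "(*)" u by fact
    have uf: "multilinear s (*) (\<lambda>xs. u (f xs))"
      using multilinear_comp[OF f u(1)] .
    have ug: "Vector_Spaces.linear tscale (*) (\<lambda>t. u (g t))"
      using linear_comp[OF g(1) u(1)] .
    interpret P: vector_space_pair "tscale :: 'k \<Rightarrow> ('a, 'k) tensor \<Rightarrow> _" "(*) :: 'k \<Rightarrow> _"
      using vector_space_field vector_space_tscale by (simp add: vector_space_pair_def)
    have "u (g (tensor s xs)) = tensor s xs (\<lambda>xs. u (f xs))"
    proof (rule P.linear_eq_on[OF ug linear_eval])
      show "tensor s xs \<in> vs1.span B" using B(3) by auto
      fix b assume b: "b \<in> B"
      have "b (\<lambda>xs. u (f xs)) = tensor s (r b) (\<lambda>xs. u (f xs))" using r[OF b] by simp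
      also have "\<dots> = u (f (r b))" using uf by (simp add: tensor_def)
      finally show "u (g b) = b (\<lambda>xs. u (f xs))" using g(2)[OF b] by simp
    qed
    also have "\<dots> = u (f xs)" using uf by (simp add: tensor_def)
    finally show False using u(2) by (simp add: u.diff)
  qed
  with g(1) show ?thesis by blast
qed

lemma tensor_lift:
  assumes "multilinear s s' f"
  shows linear_tensor_lift: "Vector_Spaces.linear tscale s' (tensor_lift s s' f)"
    and tensor_lift_tensor: "tensor_lift s s' f (tensor s xs) = f xs"
  using someI_ex[OF tensor_lift_exists[OF assms]] by (auto simp: tensor_lift_def)

lemma tensor_lift_unique:
  fixes s :: "'k::field \<Rightarrow> 'a::ab_group_add \<Rightarrow> 'a" and s' :: "'k \<Rightarrow> 'b::ab_group_add \<Rightarrow> 'b"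
  assumes "Vector_Spaces.linear tscale s' g" "Vector_Spaces.linear tscale s' g'"
    and "\<And>xs. xs \<in> lists V \<Longrightarrow> g (tensor s xs) = g' (tensor s xs)"
    and "t \<in> tensor_algebra s V"
  shows "g t = g' t"
proof -
  interpret vector_space_pair "tscale :: 'k \<Rightarrow> ('a, 'k) tensor \<Rightarrow> _" s'
    unfolding vector_space_pair_def using linearD(1,2)[OF assms(1)] by blast
  show ?thesis
    using linear_eq_on[OF assms(1,2)] assms(3,4) by (auto simp: tensor_algebra_def)
qed

lemma multilinear_bilinear:
  assumes "\<And>x. Vector_Spaces.linear s s' (f x)" "\<And>y. Vector_Spaces.linear s s' (\<lambda>x. f x y)"
  shows "multilinear s s' (\<lambda>xs. case xs of [x, y] \<Rightarrow> f x y | _ \<Rightarrow> 0)"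
  unfolding multilinear_def
proof (intro allI)
  fix us vs
  have vs: "vector_space s" "vector_space s'" using linearD[OF assms(1)] by auto
  then have "module s'" by (simp add: module_iff_vector_space)
  then have 0: "Vector_Spaces.linear s s' (\<lambda>_. 0)"
    by (intro linearI vs) (auto simp: module.scale_zero_right)
  show "Vector_Spaces.linear s s' (\<lambda>x. case us @ x # vs of [x, y] \<Rightarrow> f x y | _ \<Rightarrow> 0)"
  proof (cases us)
    case Nil
    then show ?thesis using assms 0 by (cases vs; cases "tl vs") auto
  next
    case (Cons a us')
    then show ?thesis using assms 0
      by (cases us'; cases "tl us'"; cases vs; auto split: list.splits)
  qed
qed

lemma bilinear_lift:
  assumes "\<And>x. Vector_Spaces.linear s s' (f x)" "\<And>y. Vector_Spaces.linear s s' (\<lambda>x. f x y)"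
  shows linear_bilinear_lift: "Vector_Spaces.linear tscale s' (bilinear_lift s s' f)"
    and bilinear_lift_tensor: "bilinear_lift s s' f (tensor s [x, y]) = f x y"
  using tensor_lift[OF multilinear_bilinear[of s s' f]] assms by (simp_all add: bilinear_lift_def)

lemma multilinear_append:
  assumes "vector_space s"
  shows "multilinear s tscale (\<lambda>vs. tensor s (us @ vs))"
    and "multilinear s tscale (\<lambda>us. tensor s (us @ vs))"
proof -
  have "Vector_Spaces.linear s tscale (\<lambda>x. tensor s ((us @ us') @ x # vs'))" for us' vs'
    using multilinear_tensor[OF assms] unfolding multilinear_def by blast
  then show "multilinear s tscale (\<lambda>vs. tensor s (us @ vs))" by (simp add: multilinear_def)
  have "Vector_Spaces.linear s tscale (\<lambda>x. tensor s (us' @ x # (vs' @ vs)))" for us' vs'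
    using multilinear_tensor[OF assms] unfolding multilinear_def by blast
  then show "multilinear s tscale (\<lambda>us. tensor s (us @ vs))" by (simp add: multilinear_def)
qed

lemma tensor_concat_tensor:
  assumes "vector_space s"
  shows "tensor_concat s (tensor s us) (tensor s vs) = tensor s (us @ vs)"
proof -
  have "(\<lambda>us. tensor_lift s tscale (\<lambda>vs. tensor s (us @ vs)) (tensor s vs)) = (\<lambda>us. tensor s (us @ vs))"
    using tensor_lift_tensor[OF multilinear_append(1)[OF assms]] by auto
  then show ?thesis
    unfolding tensor_concat_def using tensor_lift_tensor[OF multilinear_append(2)[OF assms]] by metis
qed

lemma multilinear_map2:
  assumes s: "vector_space s" and f: "\<And>v. Vector_Spaces.linear s s (\<lambda>u. f u v)"
  shows "multilinear s tscale (\<lambda>us. if length us = length vs then tensor s (map2 f us vs) else 0)"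
  unfolding multilinear_def
proof (intro allI)
  fix us us'
  show "Vector_Spaces.linear s tscale
      (\<lambda>x. if length (us @ x # us') = length vs then tensor s (map2 f (us @ x # us') vs) else 0)"
  proof (cases "length us + Suc (length us') = length vs")
    case True
    define ws v ws' where "ws = take (length us) vs" and "v = vs ! length us"
      and "ws' = drop (Suc (length us)) vs"
    have vs: "vs = ws @ v # ws'"
      using True id_take_nth_drop[of "length us" vs] by (simp add: ws_def v_def ws'_def)
    have len: "length us = length ws" using True by (simp add: ws_def)
    have "Vector_Spaces.linear s tscale (\<lambda>x. tensor s (map2 f us ws @ x # map2 f us' ws'))"
      using multilinear_tensor[OF s] unfolding multilinear_def by blast
    from linear_comp[OF f[of v] this] show ?thesis
      using True len by (simp add: vs)
  next
    case False
    have "Vector_Spaces.linear s tscale (\<lambda>_. 0)"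
      by (rule linearI[OF s vector_space_tscale]) (auto simp: tscale_def)
    then show ?thesis using False by simp
  qed
qed

lemma tensor_mult_tensor:
  assumes H: "k_algebra H"
  shows "tensor_mult H (tensor (scale H) us) (tensor (scale H) vs)
    = (if length us = length vs then tensor (scale H) (map2 (mult H) us vs) else 0)"
proof -
  have s: "vector_space (scale H)"
    and l: "Vector_Spaces.linear (scale H) (scale H) (\<lambda>u. mult H u v)"
    and r: "Vector_Spaces.linear (scale H) (scale H) (\<lambda>u. mult H v u)" for v
    using H by (simp_all add: k_algebra_def)
  have eq: "(\<lambda>vs. if length us = length vs then tensor (scale H) (map2 (mult H) us vs) else 0)
      = (\<lambda>vs. if length vs = length us then tensor (scale H) (map2 (\<lambda>v u. mult H u v) vs us) else 0)" for us
    by (subst zip_commute) (auto simp: fun_eq_iff comp_def case_prod_unfold)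
  have m: "multilinear (scale H) tscale
      (\<lambda>vs. if length us = length vs then tensor (scale H) (map2 (mult H) us vs) else 0)" for us
    unfolding eq by (rule multilinear_map2[OF s r])
  show ?thesis
    unfolding tensor_mult_def tensor_lift_tensor[OF m]
    by (rule tensor_lift_tensor[OF multilinear_map2[OF s l]])
qed

lemma tensor_act_tensor:
  assumes M: "hopf_module H s act"
  shows "tensor_act H s act (tensor (scale H) [g, h]) (tensor s [a, b]) = tensor s [act g a, act h b]"
proof -
  have s: "vector_space s" using M linearD(1) unfolding hopf_module_def by blast
  have 2: "Vector_Spaces.linear s tscale (\<lambda>b. tensor s [c, b])" for c
    using multilinear_tensor[OF s, unfolded multilinear_def, rule_format, of "[c]" "[]"] by simp
  have 1: "Vector_Spaces.linear s tscale (\<lambda>b. tensor s [b, c])" for c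
    using multilinear_tensor[OF s, unfolded multilinear_def, rule_format, of "[]" "[c]"] by simp
  have c1: "Vector_Spaces.linear s0 tscale (\<lambda>x. tensor s [L x, c])"
    and c2: "Vector_Spaces.linear s0 tscale (\<lambda>x. tensor s [c, L x])"
    if "Vector_Spaces.linear s0 s L" for L :: "'z::ab_group_add \<Rightarrow> _" and s0 c
    using linear_comp[OF that 1] linear_comp[OF that 2] by simp_all
  have "(\<lambda>g h. bilinear_lift s tscale (\<lambda>a b. tensor s [act g a, act h b]) (tensor s [a, b]))
      = (\<lambda>g h. tensor s [act g a, act h b])"
    using M by (intro ext bilinear_lift_tensor c1 c2) (auto simp: hopf_module_def)
  moreover have "bilinear_lift (scale H) tscale (\<lambda>g h. tensor s [act g a, act h b])
      (tensor (scale H) [g, h]) = tensor s [act g a, act h b]"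
    using M by (intro bilinear_lift_tensor c1 c2) (auto simp: hopf_module_def)
  ultimately show ?thesis unfolding tensor_act_def by simp
qed

end

theory Submission
  imports Defs
begin

text \<open>Let \<open>\<Psi>\<close> be the degree-preserving linear endomorphism of \<open>T(V)\<close> with \<open>\<Psi> 1 = 1\<close> and
  \<open>\<Psi> (a \<otimes> x) = \<Sum> (\<mu>\<^sub>1 \<rhd> a) \<otimes> \<Psi> (\<mu>\<^sub>2 \<rhd> x)\<close> for \<open>a \<in> V\<close>. The cocycle identity and
  coassociativity give \<open>\<Psi> (x \<otimes> y) = \<Sum> \<Psi> (\<mu>\<^sub>1 \<rhd> x) \<otimes> \<Psi> (\<mu>\<^sub>2 \<rhd> y)\<close>, invertibility of \<open>\<mu>\<close> makes
  \<open>\<Psi>\<close> surjective, and \<open>\<Psi>\<close> is the action of \<open>\<mu>\<close> on \<open>V \<otimes> V\<close>. Since the product of \<open>A\<close> is the twisted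
  product precomposed with \<open>\<mu>\<close>, the canonical maps \<open>\<phi>\<close> to \<open>A\<close> and \<open>\<psi>\<close> to \<open>A\<^sub>\<mu>\<close> satisfy \<open>\<phi> = \<psi> \<circ> \<Psi>\<close>; so
  \<open>\<psi>\<close> is surjective and kills \<open>R\<^sub>\<mu> = \<Psi> (R)\<close>. Conversely, \<open>R = (R) \<inter> V \<otimes> V\<close> is stable under \<open>H\<close>, hence
  \<open>{x. \<forall>h. \<Psi> (h \<rhd> x) \<in> (R\<^sub>\<mu>)}\<close> is an ideal containing \<open>R\<close>; so \<open>\<Psi>\<close> maps
  \<open>(R) = ker \<phi>\<close> into \<open>(R\<^sub>\<mu>)\<close>, and \<open>ker \<psi> = \<Psi> (ker \<phi>) \<subseteq> (R\<^sub>\<mu>)\<close>.\<close>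

section \<open>Linear maps and tensors\<close>

interpretation tens: vector_space "tscale :: 'k::field \<Rightarrow> ('a, 'k) tensor \<Rightarrow> ('a, 'k) tensor"
  by (rule vector_space_tscale)

declare plus_fun_apply [simp del] zero_fun_apply [simp del]

lemma linear_0:
  assumes "Vector_Spaces.linear s s' f"
  shows "f 0 = 0"
  using linearD(3)[OF assms, of 0 0] by simp

lemma linear_zero_fun:
  assumes "vector_space s" "vector_space s'"
  shows "Vector_Spaces.linear s s' (\<lambda>_. 0)"
  using assms by (intro linearI) (auto simp: module.scale_zero_right module_iff_vector_space)

lemma linear_add_fun:
  assumes "Vector_Spaces.linear s s' f" "Vector_Spaces.linear s s' g"
  shows "Vector_Spaces.linear s s' (\<lambda>x. f x + g x)"
proof -
  interpret f: Vector_Spaces.linear s s' f by fact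
  interpret g: Vector_Spaces.linear s s' g by fact
  show ?thesis
    by (rule linearI[OF f.vs1.vector_space_axioms f.vs2.vector_space_axioms])
      (simp_all add: f.add g.add f.scale g.scale f.vs2.scale_right_distrib)
qed

lemma linear_scale_fun:
  assumes "Vector_Spaces.linear s s' f"
  shows "Vector_Spaces.linear s s' (\<lambda>x. s' c (f x))"
proof -
  interpret f: Vector_Spaces.linear s s' f by fact
  show ?thesis
    by (rule linearI[OF f.vs1.vector_space_axioms f.vs2.vector_space_axioms])
      (simp_all add: f.add f.scale f.vs2.scale_right_distrib f.vs2.scale_left_commute)
qed

lemma linear_scaled_vector:
  fixes e :: "'a::ab_group_add \<Rightarrow> 'k::field"
  assumes "Vector_Spaces.linear s (*) e" "vector_space s'"
  shows "Vector_Spaces.linear s s' (\<lambda>x. s' (e x) v)"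
proof -
  interpret vector_space s' by fact
  show ?thesis
    by (rule linearI[OF linearD(1)[OF assms(1)] assms(2)])
      (simp_all add: linearD(3,4)[OF assms(1)] scale_left_distrib)
qed

text \<open>Together with the two closure lemmas that follow, this makes the multilinear maps a
  subspace. That is what an induction over the tensor parameter of a multilinear map
  requires.\<close>

lemma multilinear_zero:
  assumes "vector_space s" "vector_space s'"
  shows "multilinear s s' (\<lambda>_. 0)"
  using linear_zero_fun[OF assms] by (simp add: multilinear_def)

lemma multilinear_add:
  assumes "multilinear s s' f" "multilinear s s' g"
  shows "multilinear s s' (\<lambda>xs. f xs + g xs)"
  using assms linear_add_fun unfolding multilinear_def by blast

lemma multilinear_scale:
  assumes "multilinear s s' f"
  shows "multilinear s s' (\<lambda>xs. s' c (f xs))"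
  using assms linear_scale_fun unfolding multilinear_def by blast

lemma multilinearD:
  assumes "multilinear s s' f"
  shows "vector_space s" "vector_space s'"
  using assms linearD(1,2) unfolding multilinear_def by blast+

section \<open>Spans of pure tensors: membership, induction and comparison of linear maps\<close>

lemma tensor_in_algebra: "xs \<in> lists V \<Longrightarrow> tensor s xs \<in> tensor_algebra s V"
  by (simp add: tensor_algebra_def tens.span_base)

lemma subspace_tensor_algebra: "module.subspace tscale (tensor_algebra s V)"
  by (simp add: tensor_algebra_def tens.subspace_span)

lemmas tensor_algebra_add = tens.subspace_add[OF subspace_tensor_algebra]
  and tensor_algebra_scale = tens.subspace_scale[OF subspace_tensor_algebra]
  and tensor_algebra_0 = tens.subspace_0[OF subspace_tensor_algebra]

lemma tensor_algebra_mono: "V \<subseteq> V' \<Longrightarrow> tensor_algebra s V \<subseteq> tensor_algebra s V'"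
  unfolding tensor_algebra_def by (intro tens.span_mono image_mono lists_mono)

lemma tensor_algebra_UNIV: "x \<in> tensor_algebra s V \<Longrightarrow> x \<in> tensor_algebra s UNIV"
  using tensor_algebra_mono[of V UNIV] by blast

lemma tensor_power_subset: "tensor_power s n V \<subseteq> tensor_algebra s V"
  unfolding tensor_power_def tensor_algebra_def by (intro tens.span_mono image_mono) auto

lemma tensor_algebra_induct [consumes 1, case_names subspace tensor]:
  assumes "x \<in> tensor_algebra s V"
    and "module.subspace tscale {x. P x}"
    and "\<And>xs. xs \<in> lists V \<Longrightarrow> P (tensor s xs)"
  shows "P x"
  using tens.span_induct[of x "tensor s ` lists V" P] assms by (auto simp: tensor_algebra_def)

lemma tensor_power_induct [consumes 1, case_names subspace tensor]:
  assumes "x \<in> tensor_power s n V"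
    and "module.subspace tscale {x. P x}"
    and "\<And>xs. xs \<in> lists V \<Longrightarrow> length xs = n \<Longrightarrow> P (tensor s xs)"
  shows "P x"
  using tens.span_induct[of x "tensor s ` {xs \<in> lists V. length xs = n}" P] assms
  by (auto simp: tensor_power_def)

lemma linear_subspace_eq:
  assumes "Vector_Spaces.linear tscale s' f" "Vector_Spaces.linear tscale s' g"
  shows "module.subspace tscale {x. f x = g x}"
  by (rule tens.subspaceI)
    (simp_all add: linear_0[OF assms(1)] linear_0[OF assms(2)] linearD(3,4)[OF assms(1)]
      linearD(3,4)[OF assms(2)])

lemma linear_subspace_vimage:
  assumes f: "Vector_Spaces.linear tscale s' f" and S: "module.subspace s' S"
  shows "module.subspace tscale {x. f x \<in> S}"
proof -
  have "module s'" using linearD(2)[OF f] by (simp add: module_iff_vector_space)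
  then show ?thesis
    by (intro tens.subspaceI)
      (simp_all add: linear_0[OF f] linearD(3,4)[OF f] module.subspace_0[OF _ S]
        module.subspace_add[OF _ S] module.subspace_scale[OF _ S])
qed

lemma tensor_algebra_eqI:
  assumes "x \<in> tensor_algebra s V" "Vector_Spaces.linear tscale s' f"
    "Vector_Spaces.linear tscale s' g" "\<And>xs. xs \<in> lists V \<Longrightarrow> f (tensor s xs) = g (tensor s xs)"
  shows "f x = g x"
  by (rule tensor_lift_unique[OF assms(2,3,4,1)])

text \<open>Functions of the form \<open>\<lambda>x y. tensor_lift s s'' (\<lambda>us. tensor_lift s' s'' (F us) y) x\<close>
  extend \<open>F\<close> bilinearly, but the linearity in \<open>x\<close> requires \<open>y\<close> to be a genuine tensor and vice
  versa, because \<^const>\<open>tensor_lift\<close> is only determined on these.\<close>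

context
  fixes s :: "'k::field \<Rightarrow> 'a::ab_group_add \<Rightarrow> 'a" and s' :: "'k \<Rightarrow> 'b::ab_group_add \<Rightarrow> 'b"
    and s'' :: "'k \<Rightarrow> 'c::ab_group_add \<Rightarrow> 'c" and F
  assumes F2: "\<And>us. multilinear s' s'' (F us)" and F1: "\<And>vs. multilinear s s'' (\<lambda>us. F us vs)"
begin

lemma multilinear_tensor_lift:
  assumes "y \<in> tensor_algebra s' UNIV"
  shows "multilinear s s'' (\<lambda>us. tensor_lift s' s'' (F us) y)"
  using assms
proof (induction rule: tensor_algebra_induct)
  case subspace
  show ?case
    using linearD(3,4)[OF linear_tensor_lift[OF F2]] linear_0[OF linear_tensor_lift[OF F2]]
      multilinear_zero[OF multilinearD[OF F1]]
    by (intro tens.subspaceI) (auto intro: multilinear_add multilinear_scale)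
next
  case (tensor vs)
  then show ?case using F1 by (simp add: tensor_lift_tensor[OF F2])
qed

lemma linear_double_lift_left:
  assumes "y \<in> tensor_algebra s' UNIV"
  shows "Vector_Spaces.linear tscale s'' (\<lambda>x. tensor_lift s s'' (\<lambda>us. tensor_lift s' s'' (F us) y) x)"
  by (rule linear_tensor_lift[OF multilinear_tensor_lift[OF assms]])

lemma double_lift_tensor_left:
  assumes "y \<in> tensor_algebra s' UNIV"
  shows "tensor_lift s s'' (\<lambda>us. tensor_lift s' s'' (F us) y) (tensor s us) = tensor_lift s' s'' (F us) y"
  by (rule tensor_lift_tensor[OF multilinear_tensor_lift[OF assms]])

text \<open>For fixed \<open>y\<close> and \<open>y'\<close> both sides are linear in
  \<open>x\<close>, so they need only be compared on pure tensors, where the inner lift is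
  additive.\<close>

lemma double_lift_add_right:
  assumes x: "x \<in> tensor_algebra s UNIV"
    and y: "y \<in> tensor_algebra s' UNIV" "y' \<in> tensor_algebra s' UNIV"
  shows "tensor_lift s s'' (\<lambda>us. tensor_lift s' s'' (F us) (y + y')) x
    = tensor_lift s s'' (\<lambda>us. tensor_lift s' s'' (F us) y) x
      + tensor_lift s s'' (\<lambda>us. tensor_lift s' s'' (F us) y') x"
  using x
proof (rule tensor_algebra_eqI)
  show "Vector_Spaces.linear tscale s''
      (\<lambda>x. tensor_lift s s'' (\<lambda>us. tensor_lift s' s'' (F us) (y + y')) x)"
    by (intro linear_double_lift_left tensor_algebra_add y)
  show "Vector_Spaces.linear tscale s''
      (\<lambda>x. tensor_lift s s'' (\<lambda>us. tensor_lift s' s'' (F us) y) x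
        + tensor_lift s s'' (\<lambda>us. tensor_lift s' s'' (F us) y') x)"
    by (intro linear_add_fun linear_double_lift_left y)
qed (simp only: double_lift_tensor_left y tensor_algebra_add,
    simp only: linearD(3)[OF linear_tensor_lift[OF F2]])

lemma double_lift_scale_right:
  assumes x: "x \<in> tensor_algebra s UNIV" and y: "y \<in> tensor_algebra s' UNIV"
  shows "tensor_lift s s'' (\<lambda>us. tensor_lift s' s'' (F us) (tscale c y)) x
    = s'' c (tensor_lift s s'' (\<lambda>us. tensor_lift s' s'' (F us) y) x)"
  using x
proof (rule tensor_algebra_eqI)
  show "Vector_Spaces.linear tscale s''
      (\<lambda>x. tensor_lift s s'' (\<lambda>us. tensor_lift s' s'' (F us) (tscale c y)) x)"
    by (intro linear_double_lift_left tensor_algebra_scale y)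
  show "Vector_Spaces.linear tscale s''
      (\<lambda>x. s'' c (tensor_lift s s'' (\<lambda>us. tensor_lift s' s'' (F us) y) x))"
    by (intro linear_scale_fun linear_double_lift_left y)
qed (simp only: double_lift_tensor_left y tensor_algebra_scale,
    simp only: linearD(4)[OF linear_tensor_lift[OF F2]])

end

section \<open>Concatenation as a bilinear, associative product\<close>

lemma tensor_concat_closed:
  assumes s: "vector_space s" and x: "x \<in> tensor_algebra s V" and y: "y \<in> tensor_algebra s V"
  shows "tensor_concat s x y \<in> tensor_algebra s V"
proof -
  note F = multilinear_append[OF s]
  have pure: "tensor_concat s (tensor s us) y \<in> tensor_algebra s V" if "us \<in> lists V" for us
  proof -
    have "tensor_lift s tscale (\<lambda>vs. tensor s (us @ vs)) y \<in> tensor_algebra s V"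
      using y
    proof (induction rule: tensor_algebra_induct)
      case subspace
      show ?case
        by (intro linear_subspace_vimage[OF linear_tensor_lift] F subspace_tensor_algebra)
    next
      case (tensor vs)
      then show ?case using that by (simp add: tensor_lift_tensor[OF F(1)] tensor_in_algebra)
    qed
    then show ?thesis
      unfolding tensor_concat_def
      using double_lift_tensor_left[OF F, OF tensor_algebra_UNIV[OF y]] by simp
  qed
  from x show ?thesis
  proof (induction rule: tensor_algebra_induct)
    case subspace
    show ?case unfolding tensor_concat_def
      by (intro linear_subspace_vimage[OF linear_double_lift_left[OF F]] tensor_algebra_UNIV[OF y]
          subspace_tensor_algebra)
  qed (rule pure)
qed

lemma
  assumes s: "vector_space s"
  shows linear_tensor_concat_left: "y \<in> tensor_algebra s UNIV \<Longrightarrow>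
      Vector_Spaces.linear tscale tscale (\<lambda>x. tensor_concat s x y)"
    and tensor_concat_add_right: "x \<in> tensor_algebra s UNIV \<Longrightarrow> y \<in> tensor_algebra s UNIV \<Longrightarrow>
      y' \<in> tensor_algebra s UNIV \<Longrightarrow> tensor_concat s x (y + y') = tensor_concat s x y + tensor_concat s x y'"
    and tensor_concat_scale_right: "x \<in> tensor_algebra s UNIV \<Longrightarrow> y \<in> tensor_algebra s UNIV \<Longrightarrow>
      tensor_concat s x (tscale c y) = tscale c (tensor_concat s x y)"
  unfolding tensor_concat_def
  by (rule linear_double_lift_left[OF multilinear_append[OF s]]
      double_lift_add_right[OF multilinear_append[OF s]]
      double_lift_scale_right[OF multilinear_append[OF s]]; assumption)+

lemma linear_tensor_concat_right:
  assumes s: "vector_space s" and x: "x \<in> tensor_algebra s UNIV"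
    and f: "Vector_Spaces.linear s0 tscale f" "\<And>z. f z \<in> tensor_algebra s UNIV"
  shows "Vector_Spaces.linear s0 tscale (\<lambda>z. tensor_concat s x (f z))"
  using linearD(1)[OF f(1)] vector_space_tscale
  by (rule linearI)
    (simp_all add: linearD(3,4)[OF f(1)] tensor_concat_add_right[OF s x]
      tensor_concat_scale_right[OF s x] f(2))

text \<open>Here the closure cases also provide membership in the tensor algebra. This matters for
  properties built on laws such as \<open>tensor_concat_add_right\<close>, which are available for
  genuine tensors only.\<close>

lemma tensor_algebra_induct_on [consumes 1, case_names zero add scale tensor]:
  assumes x: "x \<in> tensor_algebra s V"
    and "P 0"
    and "\<And>x y. x \<in> tensor_algebra s V \<Longrightarrow> y \<in> tensor_algebra s V \<Longrightarrow> P x \<Longrightarrow> P y \<Longrightarrow> P (x + y)"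
    and "\<And>c x. x \<in> tensor_algebra s V \<Longrightarrow> P x \<Longrightarrow> P (tscale c x)"
    and "\<And>xs. xs \<in> lists V \<Longrightarrow> P (tensor s xs)"
  shows "P x"
proof -
  have "x \<in> tensor_algebra s V \<and> P x"
    using x
  proof (induction rule: tensor_algebra_induct)
    case subspace
    show ?case
      using assms(2-4) by (intro tens.subspaceI)
        (auto simp: tensor_algebra_0 tensor_algebra_add tensor_algebra_scale)
  qed (use assms(5) in \<open>auto simp: tensor_in_algebra\<close>)
  then show ?thesis ..
qed

text \<open>On pure tensors this is associativity of \<open>@\<close>. The three arguments are
  released from purity one at a time, in the order \<open>z\<close>, \<open>y\<close>,
  \<open>x\<close>.\<close>

lemma tensor_concat_assoc:
  assumes s: "vector_space s" and x: "x \<in> tensor_algebra s UNIV" and y: "y \<in> tensor_algebra s UNIV"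
    and z: "z \<in> tensor_algebra s UNIV"
  shows "tensor_concat s (tensor_concat s x y) z = tensor_concat s x (tensor_concat s y z)"
proof -
  note l = linear_tensor_concat_left[OF s] and c = tensor_concat_closed[OF s]
  note r = tensor_concat_add_right[OF s] tensor_concat_scale_right[OF s]
  have p: "tensor s us \<in> tensor_algebra s UNIV" for us by (simp add: tensor_in_algebra)
  have r0: "tensor_concat s w 0 = 0" if "w \<in> tensor_algebra s UNIV" for w
    using r(1)[OF that tensor_algebra_0 tensor_algebra_0] by simp
  have 1: "tensor_concat s (tensor s (us @ vs)) z = tensor_concat s (tensor s us) (tensor_concat s (tensor s vs) z)"
    for us vs
    using z by (induction rule: tensor_algebra_induct_on)
      (simp_all add: tensor_concat_tensor[OF s] r r0 p c)
  have 2: "tensor_concat s (tensor_concat s (tensor s us) y) z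
      = tensor_concat s (tensor s us) (tensor_concat s y z)" for us
    using y
    by (induction rule: tensor_algebra_induct_on)
      (simp_all add: tensor_concat_tensor[OF s] r r0 p c z 1 linear_0[OF l[OF z]]
        linearD(3,4)[OF l[OF z]])
  show ?thesis
    using x
  proof (rule tensor_algebra_eqI)
    show "Vector_Spaces.linear tscale tscale (\<lambda>x. tensor_concat s (tensor_concat s x y) z)"
      by (rule linear_comp[OF l[OF y] l[OF z]])
    show "Vector_Spaces.linear tscale tscale (\<lambda>x. tensor_concat s x (tensor_concat s y z))"
      by (intro l c y z)
  qed (rule 2)
qed

section \<open>Sweedler sums\<close>

definition bilin ::
  "('k::field \<Rightarrow> 'a::ab_group_add \<Rightarrow> 'a) \<Rightarrow> ('k \<Rightarrow> 'b::ab_group_add \<Rightarrow> 'b) \<Rightarrow> ('a \<Rightarrow> 'a \<Rightarrow> 'b) \<Rightarrow> bool" where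
  "bilin s s' f \<longleftrightarrow>
    (\<forall>x. Vector_Spaces.linear s s' (\<lambda>y. f x y)) \<and> (\<forall>y. Vector_Spaces.linear s s' (\<lambda>x. f x y))"

definition trilin ::
  "('k::field \<Rightarrow> 'a::ab_group_add \<Rightarrow> 'a) \<Rightarrow> ('k \<Rightarrow> 'b::ab_group_add \<Rightarrow> 'b)
    \<Rightarrow> ('a \<Rightarrow> 'a \<Rightarrow> 'a \<Rightarrow> 'b) \<Rightarrow> bool" where
  "trilin s s' f \<longleftrightarrow>
    (\<forall>y z. Vector_Spaces.linear s s' (\<lambda>x. f x y z)) \<and>
    (\<forall>x z. Vector_Spaces.linear s s' (\<lambda>y. f x y z)) \<and>
    (\<forall>x y. Vector_Spaces.linear s s' (\<lambda>z. f x y z))"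

lemma bilinI:
  assumes "\<And>x. Vector_Spaces.linear s s' (\<lambda>y. f x y)" "\<And>y. Vector_Spaces.linear s s' (\<lambda>x. f x y)"
  shows "bilin s s' f"
  using assms by (simp add: bilin_def)

lemma bilinD:
  assumes "bilin s s' f"
  shows "Vector_Spaces.linear s s' (\<lambda>y. f x y)" "Vector_Spaces.linear s s' (\<lambda>x. f x y)"
  using assms by (simp_all add: bilin_def)

lemma trilinI:
  assumes "\<And>y z. Vector_Spaces.linear s s' (\<lambda>x. f x y z)"
    "\<And>x z. Vector_Spaces.linear s s' (\<lambda>y. f x y z)"
    "\<And>x y. Vector_Spaces.linear s s' (\<lambda>z. f x y z)"
  shows "trilin s s' f"
  using assms by (simp add: trilin_def)

lemma trilinD:
  assumes "trilin s s' f"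
  shows "Vector_Spaces.linear s s' (\<lambda>x. f x y z)" "Vector_Spaces.linear s s' (\<lambda>y. f x y z)"
    "Vector_Spaces.linear s s' (\<lambda>z. f x y z)"
  using assms by (simp_all add: trilin_def)

lemma multilinear_trilinear:
  fixes f :: "'a::ab_group_add \<Rightarrow> 'a \<Rightarrow> 'a \<Rightarrow> 'b::ab_group_add"
  assumes f: "trilin s s' f"
  shows "multilinear s s' (\<lambda>xs. case xs of [x, y, z] \<Rightarrow> f x y z | _ \<Rightarrow> 0)"
  unfolding multilinear_def
proof (intro allI)
  fix us vs :: "'a list"
  have 0: "Vector_Spaces.linear s s' (\<lambda>_. 0)"
    using trilinD(1)[OF f] by (intro linear_zero_fun) (blast dest: linearD)+
  let ?F = "\<lambda>us vs (x :: 'a). case us @ x # vs of [x, y, z] \<Rightarrow> f x y z | _ \<Rightarrow> 0"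
  \<comment> \<open>The slot is the first, second or third of exactly three entries; for every other
    total length the default value 0 applies.\<close>
  consider y z where "us = []" "vs = [y, z]" | y z where "us = [y]" "vs = [z]"
    | y z where "us = [y, z]" "vs = []" | "length us + length vs \<noteq> 2"
    by (cases us; cases "tl us"; cases "tl (tl us)"; cases vs; cases "tl vs"; cases "tl (tl vs)") auto
  then show "Vector_Spaces.linear s s' (?F us vs)"
  proof cases
    case 4
    then have "?F us vs = (\<lambda>_. 0)" by (auto split: list.splits simp: fun_eq_iff append_eq_Cons_conv)
    then show ?thesis using 0 by simp
  qed (use trilinD[OF f] in simp_all)
qed

text \<open>A choice of decomposition of an element of the tensor square into pure tensors: a Sweedler sum
  \<open>t = \<Sum> g \<otimes> h\<close> is turned into an honest sum, which commutes with additive maps and with other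
  such sums without any bilinearity assumption on the summand.\<close>

definition ssum ::
  "('k::field \<Rightarrow> 'a::ab_group_add \<Rightarrow> 'a) \<Rightarrow> ('a, 'k) tensor \<Rightarrow> ('a \<Rightarrow> 'a \<Rightarrow> 'b::comm_monoid_add) \<Rightarrow> 'b" where
  "ssum s t f = (\<Sum>p\<leftarrow>(SOME ps. t = (\<Sum>(g, h)\<leftarrow>ps. tensor s [g, h])). f (fst p) (snd p))"

text \<open>A scalar can be absorbed into the left factor of each pure tensor, so a list of pairs
  without coefficients is enough.\<close>

lemma tensor_pairs_exist:
  assumes s: "vector_space s" and t: "t \<in> tensor_power s 2 V"
  shows "\<exists>ps. t = (\<Sum>(g, h)\<leftarrow>ps. tensor s [g, h])"
  using t
proof (induction rule: tensor_power_induct)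
  case subspace
  have scale: "tensor s [s c g, h] = tscale c (tensor s [g, h])" for c g h
    using linearD(4)[OF multilinear_tensor[OF s, unfolded multilinear_def, rule_format], of "[]" c g "[h]"]
    by simp
  show ?case
  proof (intro tens.subspaceI CollectI)
    show "\<exists>ps. 0 = (\<Sum>(g, h)\<leftarrow>ps. tensor s [g, h])" by (rule exI[of _ "[]"]) simp
    fix x y c
    assume x: "x \<in> {t. \<exists>ps. t = (\<Sum>(g, h)\<leftarrow>ps. tensor s [g, h])}"
    then obtain ps where ps: "x = (\<Sum>(g, h)\<leftarrow>ps. tensor s [g, h])" by blast
    have "tscale c (\<Sum>(g, h)\<leftarrow>ps. tensor s [g, h]) = (\<Sum>(g, h)\<leftarrow>map (map_prod (s c) id) ps. tensor s [g, h])"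
      by (induction ps) (auto simp: tens.scale_right_distrib scale)
    then show "\<exists>ps. tscale c x = (\<Sum>(g, h)\<leftarrow>ps. tensor s [g, h])" using ps by metis
    assume "y \<in> {t. \<exists>ps. t = (\<Sum>(g, h)\<leftarrow>ps. tensor s [g, h])}"
    then obtain qs where "y = (\<Sum>(g, h)\<leftarrow>qs. tensor s [g, h])" by blast
    with ps show "\<exists>ps. x + y = (\<Sum>(g, h)\<leftarrow>ps. tensor s [g, h])"
      by (intro exI[of _ "ps @ qs"]) simp
  qed
next
  case (tensor xs)
  then obtain g h where "xs = [g, h]" by (auto simp: length_Suc_conv numeral_2_eq_2)
  then show ?case by (intro exI[of _ "[(g, h)]"]) simp
qed

lemma ssum_tensor:
  assumes "vector_space s" "t \<in> tensor_power s 2 V"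
  shows "ssum s t (\<lambda>g h. tensor s [g, h]) = t"
  using someI_ex[OF tensor_pairs_exist[OF assms]] by (simp add: ssum_def case_prod_unfold)

text \<open>Additivity of \<open>L\<close> is asked for on \<open>S\<close> only: the right argument
  of \<open>tensor_concat\<close> and of \<open>tensor_mult\<close> is known to be additive just on
  genuine tensors.\<close>

lemma ssum_map_on:
  assumes "0 \<in> S" "\<And>x y. x \<in> S \<Longrightarrow> y \<in> S \<Longrightarrow> x + y \<in> S" "\<And>g h. f g h \<in> S"
    and "L 0 = 0" "\<And>x y. x \<in> S \<Longrightarrow> y \<in> S \<Longrightarrow> L (x + y) = L x + L y"
  shows "L (ssum s t f) = ssum s t (\<lambda>g h. L (f g h))"
proof -
  have "(\<Sum>p\<leftarrow>ps. f (fst p) (snd p)) \<in> S \<and>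
      L (\<Sum>p\<leftarrow>ps. f (fst p) (snd p)) = (\<Sum>p\<leftarrow>ps. L (f (fst p) (snd p)))" for ps
    using assms by (induction ps) auto
  then show ?thesis by (simp add: ssum_def)
qed

lemma ssum_map:
  assumes "Vector_Spaces.linear s0 s' L"
  shows "L (ssum s t f) = ssum s t (\<lambda>g h. L (f g h))"
  by (rule ssum_map_on[where S = UNIV]) (simp_all add: linear_0[OF assms] linearD(3)[OF assms])

lemma ssum_add: "ssum s t (\<lambda>g h. f g h + f' g h) = ssum s t f + ssum s t f'"
  by (simp add: ssum_def sum_list_addf)

lemma ssum_0 [simp]: "ssum s t (\<lambda>g h. 0) = 0"
  by (simp add: ssum_def)

lemma ssum_in_subspace:
  assumes "module s'" "module.subspace s' S" "\<And>g h. f g h \<in> S"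
  shows "ssum s t f \<in> S"
proof -
  have "(\<Sum>p\<leftarrow>ps. f (fst p) (snd p)) \<in> S" for ps
    using assms by (induction ps) (auto simp: module.subspace_0 module.subspace_add)
  then show ?thesis by (simp add: ssum_def)
qed

lemma sum_list_swap: "(\<Sum>p\<leftarrow>ps. \<Sum>q\<leftarrow>qs. F p q) = (\<Sum>q\<leftarrow>qs. \<Sum>p\<leftarrow>ps. F p q)"
  for F :: "'a \<Rightarrow> 'b \<Rightarrow> 'c::comm_monoid_add"
  by (induction ps) (simp_all add: sum_list_addf)

lemma ssum_swap: "ssum s t (\<lambda>g h. ssum s' t' (\<lambda>k l. f g h k l)) = ssum s' t' (\<lambda>k l. ssum s t (\<lambda>g h. f g h k l))"
  unfolding ssum_def by (rule sum_list_swap)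

text \<open>The sum over \<open>t''\<close> can move outermost because \<open>t''\<close> depends on
  none of the other indices, whereas \<open>t' g h\<close> has to stay inside the sum over
  \<open>t\<close>.\<close>

lemma ssum_rotate:
  "ssum s t (\<lambda>g h. ssum s' (t' g h) (\<lambda>a b. ssum s'' t'' (\<lambda>k l. f g h a b k l)))
    = ssum s'' t'' (\<lambda>k l. ssum s t (\<lambda>g h. ssum s' (t' g h) (\<lambda>a b. f g h a b k l)))"
proof -
  have "ssum s' (t' g h) (\<lambda>a b. ssum s'' t'' (\<lambda>k l. f g h a b k l))
      = ssum s'' t'' (\<lambda>k l. ssum s' (t' g h) (\<lambda>a b. f g h a b k l))" for g h
    by (rule ssum_swap)
  then have "ssum s t (\<lambda>g h. ssum s' (t' g h) (\<lambda>a b. ssum s'' t'' (\<lambda>k l. f g h a b k l)))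
      = ssum s t (\<lambda>g h. ssum s'' t'' (\<lambda>k l. ssum s' (t' g h) (\<lambda>a b. f g h a b k l)))"
    by simp
  also have "\<dots> = ssum s'' t'' (\<lambda>k l. ssum s t (\<lambda>g h. ssum s' (t' g h) (\<lambda>a b. f g h a b k l)))"
    by (rule ssum_swap)
  finally show ?thesis .
qed

text \<open>For a bilinear summand the sum no longer depends on the chosen decomposition. This is
  the bridge between \<open>ssum\<close> and the maps defined by
  \<open>bilinear_lift\<close>.\<close>

lemma ssum_bilinear_lift:
  assumes f: "bilin s s' f" and t: "t \<in> tensor_power s 2 V"
  shows "ssum s t f = bilinear_lift s s' f t"
proof -
  have s: "vector_space s" using linearD(1)[OF bilinD(1)[OF f]] .
  have "bilinear_lift s s' f t = bilinear_lift s s' f (ssum s t (\<lambda>g h. tensor s [g, h]))"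
    by (simp add: ssum_tensor[OF s t])
  also have "\<dots> = ssum s t (\<lambda>g h. bilinear_lift s s' f (tensor s [g, h]))"
    by (rule ssum_map[OF linear_bilinear_lift[OF bilinD[OF f]]])
  also have "\<dots> = ssum s t f" by (simp add: bilinear_lift_tensor[OF bilinD[OF f]])
  finally show ?thesis ..
qed

lemma linear_ssum:
  assumes F: "\<And>g h. Vector_Spaces.linear s0 s' (\<lambda>z. F z g h)"
  shows "Vector_Spaces.linear s0 s' (\<lambda>z. ssum s t (\<lambda>g h. F z g h))"
proof (rule linearI)
  show "vector_space s0" and s': "vector_space s'" using linearD[OF F] by auto
  show "ssum s t (\<lambda>g h. F (x + y) g h) = ssum s t (F x) + ssum s t (F y)" for x y
    by (simp add: linearD(3)[OF F] ssum_add)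
  have "Vector_Spaces.linear s' s' (s' c)" for c
  proof -
    interpret vector_space s' by (rule s')
    show ?thesis by (intro linearI s') (simp_all add: scale_right_distrib scale_left_commute)
  qed
  then show "ssum s t (\<lambda>g h. F (s0 c x) g h) = s' c (ssum s t (F x))" for c x
    by (simp add: linearD(4)[OF F] ssum_map[of s' s' "s' c"])
qed

text \<open>The decomposition chosen for \<open>L z\<close> need not vary linearly with
  \<open>z\<close>; bilinearity of \<open>f\<close> allows the sum to be replaced by the lift, which
  is linear.\<close>

lemma linear_ssum_index:
  assumes L: "Vector_Spaces.linear s0 tscale L" "\<And>z. L z \<in> tensor_power s 2 V"
    and f: "bilin s s' f"
  shows "Vector_Spaces.linear s0 s' (\<lambda>z. ssum s (L z) f)"
  unfolding ssum_bilinear_lift[OF f L(2)]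
  by (rule linear_comp[OF L(1) linear_bilinear_lift[OF bilinD[OF f]]])

lemma linear_tensor_slot:
  assumes "vector_space s"
  shows "Vector_Spaces.linear s tscale (\<lambda>x. tensor s (us @ x # vs))"
  using multilinear_tensor[OF assms] by (auto simp: multilinear_def)

lemma bilin_tensor:
  assumes "vector_space s"
  shows "bilin s tscale (\<lambda>x y. tensor s [x, y])"
  using linear_tensor_slot[OF assms, of "[_]" "[]"] linear_tensor_slot[OF assms, of "[]" "[_]"]
  by (intro bilinI) simp_all

section \<open>Algebras and the componentwise product on their tensor powers\<close>

locale k_alg =
  fixes H :: "('k::field, 'h::ab_group_add, 'm) alg_scheme"
  assumes k_algebra: "k_algebra H"
begin

lemma vector_space_scale: "vector_space (scale H)"
  and linear_mult_right: "Vector_Spaces.linear (scale H) (scale H) (\<lambda>b. mult H a b)"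
  and linear_mult_left: "Vector_Spaces.linear (scale H) (scale H) (\<lambda>a. mult H a b)"
  and mult_assoc: "mult H (mult H a b) c = mult H a (mult H b c)"
  and mult_unit [simp]: "mult H (unit H) a = a" "mult H a (unit H) = a"
  using k_algebra by (auto simp: k_algebra_def)

lemma module_scale: "module (scale H)"
  using vector_space_scale by (simp add: module_iff_vector_space)

lemma tensor_in [simp]: "tensor (scale H) xs \<in> tensor_algebra (scale H) UNIV"
  by (simp add: tensor_in_algebra)

lemma ssum_tensor_algebra:
  assumes "\<And>g h. f g h \<in> tensor_algebra s V"
  shows "ssum s' t f \<in> tensor_algebra s V"
  by (rule ssum_in_subspace[OF tens.module_axioms subspace_tensor_algebra assms])

lemma
  assumes "y \<in> tensor_algebra (scale H) UNIV"
  shows linear_tensor_mult_left: "Vector_Spaces.linear tscale tscale (\<lambda>x. tensor_mult H x y)"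
    and tensor_mult_add_right: "x \<in> tensor_algebra (scale H) UNIV \<Longrightarrow> y' \<in> tensor_algebra (scale H) UNIV \<Longrightarrow>
      tensor_mult H x (y + y') = tensor_mult H x y + tensor_mult H x y'"
proof -
  note s = vector_space_scale
  \<comment> \<open>Exchanging the two lists turns multilinearity in the second factor into an
    instance of \<open>multilinear_map2\<close>, which treats the first.\<close>
  have eq: "(\<lambda>vs. if length us = length vs then tensor (scale H) (map2 (mult H) us vs) else 0)
      = (\<lambda>vs. if length vs = length us then tensor (scale H) (map2 (\<lambda>v u. mult H u v) vs us) else 0)" for us
    by (subst zip_commute) (auto simp: fun_eq_iff comp_def case_prod_unfold)
  have m: "multilinear (scale H) tscale
      (\<lambda>vs. if length us = length vs then tensor (scale H) (map2 (mult H) us vs) else 0)" for us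
    unfolding eq by (rule multilinear_map2[OF s linear_mult_right])
  note F = m multilinear_map2[OF s linear_mult_left]
  show "Vector_Spaces.linear tscale tscale (\<lambda>x. tensor_mult H x y)"
    unfolding tensor_mult_def by (rule linear_double_lift_left[OF F assms])
  show "x \<in> tensor_algebra (scale H) UNIV \<Longrightarrow> y' \<in> tensor_algebra (scale H) UNIV \<Longrightarrow>
      tensor_mult H x (y + y') = tensor_mult H x y + tensor_mult H x y'"
    unfolding tensor_mult_def by (rule double_lift_add_right[OF F _ assms])
qed

lemma tensor_mult_ssum_left:
  assumes "y \<in> tensor_algebra (scale H) UNIV"
  shows "tensor_mult H (ssum s t f) y = ssum s t (\<lambda>g h. tensor_mult H (f g h) y)"
  by (rule ssum_map[OF linear_tensor_mult_left[OF assms]])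

lemma tensor_mult_ssum_right:
  assumes x: "x \<in> tensor_algebra (scale H) UNIV" and f: "\<And>g h. f g h \<in> tensor_algebra (scale H) UNIV"
  shows "tensor_mult H x (ssum s t f) = ssum s t (\<lambda>g h. tensor_mult H x (f g h))"
  using tensor_mult_add_right[OF tensor_algebra_0 x tensor_algebra_0]
  by (intro ssum_map_on[OF tensor_algebra_0 tensor_algebra_add f] tensor_mult_add_right x) simp_all

lemma tensor_mult_ssum:
  assumes "t \<in> tensor_power (scale H) 2 UNIV" "t' \<in> tensor_power (scale H) 2 UNIV"
  shows "tensor_mult H t t' = ssum (scale H) t (\<lambda>g h. ssum (scale H) t' (\<lambda>g' h'.
    tensor (scale H) [mult H g g', mult H h h']))"
proof -
  note s = ssum_tensor[OF vector_space_scale]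
  have "tensor_mult H t t' = tensor_mult H (ssum (scale H) t (\<lambda>g h. tensor (scale H) [g, h]))
      (ssum (scale H) t' (\<lambda>g h. tensor (scale H) [g, h]))"
    by (simp add: s[OF assms(1)] s[OF assms(2)])
  also have "\<dots> = ssum (scale H) t' (\<lambda>g' h'. ssum (scale H) t (\<lambda>g h.
      tensor (scale H) [mult H g g', mult H h h']))"
    by (simp add: tensor_mult_ssum_left tensor_mult_ssum_right ssum_tensor_algebra
        tensor_mult_tensor[OF k_algebra])
  also note ssum_swap
  finally show ?thesis .
qed

lemma tensor_power2_I: "tensor (scale H) [g, h] \<in> tensor_power (scale H) 2 UNIV"
  by (auto simp: tensor_power_def intro!: tens.span_base)

lemma tensor_mult_closed:
  assumes "t \<in> tensor_power (scale H) 2 UNIV" "t' \<in> tensor_power (scale H) 2 UNIV"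
  shows "tensor_mult H t t' \<in> tensor_power (scale H) 2 UNIV"
  unfolding tensor_mult_ssum[OF assms]
  by (intro ssum_in_subspace[OF tens.module_axioms] tensor_power2_I)
    (simp_all add: tensor_power_def tens.subspace_span)

text \<open>This turns a product in \<open>H \<otimes> H\<close> into two nested sums, and read
  backwards it merges two sums into one over the product.\<close>

lemma ssum_tensor_mult:
  assumes t: "t \<in> tensor_power (scale H) 2 UNIV" "t' \<in> tensor_power (scale H) 2 UNIV"
    and f: "bilin (scale H) s' f"
  shows "ssum (scale H) (tensor_mult H t t') f = ssum (scale H) t (\<lambda>g h. ssum (scale H) t' (\<lambda>g' h'.
    f (mult H g g') (mult H h h')))"
  by (subst ssum_bilinear_lift[OF f tensor_mult_closed[OF t]], subst tensor_mult_ssum[OF t])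
    (simp add: ssum_map[OF linear_bilinear_lift[OF bilinD[OF f]]] bilinear_lift_tensor[OF bilinD[OF f]])

lemma ssum_pure:
  assumes "bilin (scale H) s' f"
  shows "ssum (scale H) (tensor (scale H) [g, h]) f = f g h"
  unfolding ssum_bilinear_lift[OF assms tensor_power2_I] bilinear_lift_tensor[OF bilinD[OF assms]] ..

text \<open>The usual argument \<nu> = \<nu> (\<mu> \<nu>') = (\<nu> \<mu>) \<nu>' = \<nu>', carried
  out in Sweedler sums so that only associativity in \<open>H\<close> itself is used. It makes the
  definite description in \<open>drinfeld_twist\<close> meaningful.\<close>

lemma inverse_tensor_unique:
  assumes \<mu>: "\<mu> \<in> tensor_power (scale H) 2 UNIV" and i: "inverse_tensor H \<mu> \<nu>" "inverse_tensor H \<mu> \<nu>'"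
  shows "\<nu> = \<nu>'"
proof -
  let ?S = "ssum (scale H)" and ?t = "\<lambda>x y. tensor (scale H) [x, y]"
  have \<nu>: "\<nu> \<in> tensor_power (scale H) 2 UNIV" "\<nu>' \<in> tensor_power (scale H) 2 UNIV"
    and e: "tensor_mult H \<nu> \<mu> = ?t (unit H) (unit H)" "tensor_mult H \<mu> \<nu>' = ?t (unit H) (unit H)"
    using i by (auto simp: inverse_tensor_def)
  have t: "bilin (scale H) tscale ?t" by (rule bilin_tensor[OF vector_space_scale])
  have r: "bilin (scale H) tscale (\<lambda>x y. ?t (mult H x u) (mult H y v))"
    and l: "bilin (scale H) tscale (\<lambda>x y. ?t (mult H u x) (mult H v y))" for u v
    by (intro bilinI linear_comp[OF linear_mult_left] linear_comp[OF linear_mult_right] bilinD[OF t])+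
  have "\<nu> = ?S \<nu> ?t" by (simp add: ssum_tensor[OF vector_space_scale \<nu>(1)])
  also have "\<dots> = ?S \<nu> (\<lambda>u v. ?S (tensor_mult H \<mu> \<nu>') (\<lambda>x y. ?t (mult H u x) (mult H v y)))"
    by (simp add: e ssum_pure[OF l])
  also have "\<dots> = ?S \<nu> (\<lambda>u v. ?S \<mu> (\<lambda>g h. ?S \<nu>' (\<lambda>u' v'.
      ?t (mult H (mult H u g) u') (mult H (mult H v h) v'))))"
    by (simp add: ssum_tensor_mult[OF \<mu> \<nu>(2) l] mult_assoc)
  also have "\<dots> = ?S \<nu> (\<lambda>u v. ?S \<nu>' (\<lambda>u' v'. ?S \<mu> (\<lambda>g h.
      ?t (mult H (mult H u g) u') (mult H (mult H v h) v'))))"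
    by (subst ssum_swap) rule
  also have "\<dots> = ?S \<nu>' (\<lambda>u' v'. ?S \<nu> (\<lambda>u v. ?S \<mu> (\<lambda>g h.
      ?t (mult H (mult H u g) u') (mult H (mult H v h) v'))))"
    by (rule ssum_swap)
  also have "\<dots> = ?S \<nu>' (\<lambda>u' v'. ?S (tensor_mult H \<nu> \<mu>) (\<lambda>x y. ?t (mult H x u') (mult H y v')))"
    by (simp add: ssum_tensor_mult[OF \<nu>(1) \<mu> r])
  also have "\<dots> = ?S \<nu>' ?t" by (simp add: e ssum_pure[OF r])
  also have "\<dots> = \<nu>'" by (simp add: ssum_tensor[OF vector_space_scale \<nu>(2)])
  finally show ?thesis .
qed

end

section \<open>The Hopf algebra axioms as identities between Sweedler sums\<close>

locale hopf =
  fixes H :: "('k::field, 'h::ab_group_add) hopf_alg"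
  assumes hopf_algebra: "hopf_algebra H"
begin

sublocale k_alg H
  using hopf_algebra by unfold_locales (simp add: hopf_algebra_def)

abbreviation "S \<equiv> ssum (scale H)"
abbreviation "\<Delta> \<equiv> comult H"
abbreviation "\<epsilon> \<equiv> counit H"
abbreviation hmult (infixl "\<cdot>" 70) where "x \<cdot> y \<equiv> mult H x y"
abbreviation "lin s' f \<equiv> Vector_Spaces.linear (scale H) s' f"

lemma linear_comult: "lin tscale \<Delta>"
  and comult_in [simp]: "\<Delta> h \<in> tensor_power (scale H) 2 UNIV"
  and linear_counit: "lin (*) \<epsilon>"
  and comult_mult: "\<Delta> (g \<cdot> h) = tensor_mult H (\<Delta> g) (\<Delta> h)"
  and comult_unit: "\<Delta> (unit H) = tensor (scale H) [unit H, unit H]"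
  and counit_mult [simp]: "\<epsilon> (g \<cdot> h) = \<epsilon> g * \<epsilon> h"
  and counit_unit [simp]: "\<epsilon> (unit H) = 1"
  and comult_coassoc: "comult_id H (\<Delta> h) = id_comult H (\<Delta> h)"
  and comult_counit: "counit_id H (\<Delta> h) = h" "id_counit H (\<Delta> h) = h"
  using hopf_algebra by (auto simp: hopf_algebra_def)

lemma comult_in_algebra [simp]: "\<Delta> h \<in> tensor_algebra (scale H) UNIV"
  using tensor_power_subset comult_in by blast

lemma comult_id_ssum:
  assumes t: "t \<in> tensor_power (scale H) 2 UNIV"
  shows "comult_id H t = S t (\<lambda>x y. S (\<Delta> x) (\<lambda>x1 x2. tensor (scale H) [x1, x2, y]))"
proof -
  note s = vector_space_scale
  note l = linear_tensor_concat_left[OF s]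
  have "bilin (scale H) tscale (\<lambda>x y. tensor_concat (scale H) (\<Delta> x) (tensor (scale H) [y]))"
    using linear_tensor_slot[OF s, of "[]" "[]"]
    by (intro bilinI linear_tensor_concat_right[OF s] linear_comp[OF linear_comult l]) simp_all
  then have "comult_id H t = S t (\<lambda>x y. tensor_concat (scale H) (\<Delta> x) (tensor (scale H) [y]))"
    unfolding comult_id_def by (rule ssum_bilinear_lift[OF _ t, symmetric])
  also have "\<dots> = S t (\<lambda>x y. tensor_concat (scale H) (S (\<Delta> x) (\<lambda>x1 x2. tensor (scale H) [x1, x2]))
      (tensor (scale H) [y]))"
    by (simp add: ssum_tensor[OF s comult_in])
  also have "\<dots> = S t (\<lambda>x y. S (\<Delta> x) (\<lambda>x1 x2. tensor (scale H) [x1, x2, y]))"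
    by (simp add: ssum_map[OF l] tensor_concat_tensor[OF s])
  finally show ?thesis .
qed

lemma tensor_concat_ssum_right:
  assumes "x \<in> tensor_algebra (scale H) UNIV" "\<And>g h. f g h \<in> tensor_algebra (scale H) UNIV"
  shows "tensor_concat (scale H) x (ssum s t f) = ssum s t (\<lambda>g h. tensor_concat (scale H) x (f g h))"
  using tensor_concat_add_right[OF vector_space_scale assms(1) tensor_algebra_0 tensor_algebra_0]
  by (intro ssum_map_on[OF tensor_algebra_0 tensor_algebra_add assms(2)]
      tensor_concat_add_right[OF vector_space_scale] assms(1)) simp_all

lemma id_comult_ssum:
  assumes t: "t \<in> tensor_power (scale H) 2 UNIV"
  shows "id_comult H t = S t (\<lambda>x y. S (\<Delta> y) (\<lambda>y1 y2. tensor (scale H) [x, y1, y2]))"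
proof -
  note s = vector_space_scale
  note l = linear_tensor_concat_left[OF s]
  have "lin tscale (\<lambda>y. tensor (scale H) [y])" using linear_tensor_slot[OF s, of "[]" "[]"] by simp
  then have "bilin (scale H) tscale (\<lambda>x y. tensor_concat (scale H) (tensor (scale H) [x]) (\<Delta> y))"
    by (intro bilinI linear_tensor_concat_right[OF s] linear_comp[OF _ l] linear_comult) simp_all
  then have "id_comult H t = S t (\<lambda>x y. tensor_concat (scale H) (tensor (scale H) [x]) (\<Delta> y))"
    unfolding id_comult_def by (rule ssum_bilinear_lift[OF _ t, symmetric])
  also have "\<dots> = S t (\<lambda>x y. tensor_concat (scale H) (tensor (scale H) [x])
      (S (\<Delta> y) (\<lambda>y1 y2. tensor (scale H) [y1, y2])))"
    by (simp add: ssum_tensor[OF s comult_in])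
  also have "\<dots> = S t (\<lambda>x y. S (\<Delta> y) (\<lambda>y1 y2. tensor (scale H) [x, y1, y2]))"
    by (simp add: tensor_concat_ssum_right tensor_concat_tensor[OF s])
  finally show ?thesis .
qed

text \<open>Equations in the triple tensor product of \<open>H\<close> are used by applying such an
  \<open>L\<close> to both sides; this is how coassociativity and the cocycle identity reach
  arbitrary trilinear expressions.\<close>

lemma trilin_lift:
  assumes f: "trilin (scale H) s' f"
  shows "\<exists>L. Vector_Spaces.linear tscale s' L \<and> (\<forall>x y z. L (tensor (scale H) [x, y, z]) = f x y z)"
  using tensor_lift[OF multilinear_trilinear[OF f]] by fastforce

lemma coassoc:
  assumes f: "trilin (scale H) s' f"
  shows "S (\<Delta> h) (\<lambda>x y. S (\<Delta> x) (\<lambda>x1 x2. f x1 x2 y)) = S (\<Delta> h) (\<lambda>x y. S (\<Delta> y) (\<lambda>y1 y2. f x y1 y2))"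
proof -
  obtain L where L: "Vector_Spaces.linear tscale s' L" "\<And>x y z. L (tensor (scale H) [x, y, z]) = f x y z"
    using trilin_lift[OF f] by blast
  have "L (comult_id H (\<Delta> h)) = L (id_comult H (\<Delta> h))" by (simp add: comult_coassoc)
  then show ?thesis by (simp add: comult_id_ssum id_comult_ssum ssum_map[OF L(1)] L(2))
qed

lemma ssum_counit:
  assumes t: "t \<in> tensor_power (scale H) 2 UNIV" and f: "lin s' f"
  shows "S t (\<lambda>x y. s' (\<epsilon> x) (f y)) = f (counit_id H t)"
    and "S t (\<lambda>x y. s' (\<epsilon> y) (f x)) = f (id_counit H t)"
proof -
  have b1: "bilin (scale H) (scale H) (\<lambda>x y. scale H (\<epsilon> x) y)"
   and b2: "bilin (scale H) (scale H) (\<lambda>x y. scale H (\<epsilon> y) x)"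
    \<comment> \<open>Multiplying by the unit on both sides is the identity map, so this yields
      linearity of scaling by a constant.\<close>
    using linear_scale_fun[OF linear_comp[OF linear_mult_left linear_mult_right], of _ "unit H" "unit H"]
    by (intro bilinI linear_scaled_vector[OF linear_counit vector_space_scale]; simp)+
  show "S t (\<lambda>x y. s' (\<epsilon> x) (f y)) = f (counit_id H t)"
    unfolding counit_id_def ssum_bilinear_lift[OF b1 t, symmetric]
    by (simp add: ssum_map[OF f] linearD(4)[OF f])
  show "S t (\<lambda>x y. s' (\<epsilon> y) (f x)) = f (id_counit H t)"
    unfolding id_counit_def ssum_bilinear_lift[OF b2 t, symmetric]
    by (simp add: ssum_map[OF f] linearD(4)[OF f])
qed

lemma counit_comult:
  assumes "lin s' f"
  shows "S (\<Delta> h) (\<lambda>x y. s' (\<epsilon> x) (f y)) = f h" "S (\<Delta> h) (\<lambda>x y. s' (\<epsilon> y) (f x)) = f h"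
  by (simp_all add: ssum_counit[OF comult_in assms] comult_counit)

lemma ssum_comult_mult:
  assumes "bilin (scale H) s' f"
  shows "S (\<Delta> (g \<cdot> h)) f = S (\<Delta> g) (\<lambda>g1 g2. S (\<Delta> h) (\<lambda>h1 h2. f (g1 \<cdot> h1) (g2 \<cdot> h2)))"
  by (simp add: comult_mult ssum_tensor_mult[OF _ _ assms])

lemma ssum_comult_unit:
  assumes "bilin (scale H) s' f"
  shows "S (\<Delta> (unit H)) f = f (unit H) (unit H)"
  by (simp add: comult_unit ssum_pure[OF assms])

end

section \<open>The cocycle and its inverse in Sweedler form\<close>

locale hopf_cocycle = hopf H for H :: "('k::field, 'h::ab_group_add) hopf_alg" +
  fixes \<mu> :: "('h, 'k) tensor"
  assumes two_cocycle: "two_cocycle H \<mu>" and counital: "counital H \<mu>"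
begin

text \<open>Literally the description that occurs in \<open>drinfeld_twist\<close>, so that folding
  this definition identifies the two.\<close>

definition "\<nu> = (THE \<nu>. inverse_tensor H \<mu> \<nu>)"

lemma cocycle_in [simp]: "\<mu> \<in> tensor_power (scale H) 2 UNIV"
  using two_cocycle by (simp add: two_cocycle_def)

lemma inverse_tensor: "inverse_tensor H \<mu> \<nu>"
proof -
  have "\<exists>!\<nu>. inverse_tensor H \<mu> \<nu>"
    using two_cocycle inverse_tensor_unique[OF cocycle_in] unfolding two_cocycle_def by blast
  then show ?thesis unfolding \<nu>_def by (rule theI')
qed

lemma inverse_in [simp]: "\<nu> \<in> tensor_power (scale H) 2 UNIV"
  using inverse_tensor by (simp add: inverse_tensor_def)

lemma ssum_cocycle_inverse:
  assumes "bilin (scale H) s' f"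
  shows "S \<mu> (\<lambda>g h. S \<nu> (\<lambda>u v. f (g \<cdot> u) (h \<cdot> v))) = f (unit H) (unit H)"
    and "S \<nu> (\<lambda>u v. S \<mu> (\<lambda>g h. f (u \<cdot> g) (v \<cdot> h))) = f (unit H) (unit H)"
  using inverse_tensor
  by (simp_all add: inverse_tensor_def ssum_pure[OF assms] flip: ssum_tensor_mult[OF _ _ assms])

lemma counital_ssum:
  assumes "lin s' f"
  shows "S \<mu> (\<lambda>x y. s' (\<epsilon> x) (f y)) = f (unit H)" "S \<mu> (\<lambda>x y. s' (\<epsilon> y) (f x)) = f (unit H)"
  using counital by (simp_all add: ssum_counit[OF cocycle_in assms] counital_def)

text \<open>Both sides of the cocycle identity are expanded into sums of pure tensors of length
  three, and the linear map induced by \<open>f\<close> is applied.\<close>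

lemma cocycle:
  assumes f: "trilin (scale H) s' f"
  shows "S \<mu> (\<lambda>g h. S (\<Delta> g) (\<lambda>g1 g2. S \<mu> (\<lambda>k l. f (k \<cdot> g1) (l \<cdot> g2) h)))
    = S \<mu> (\<lambda>g h. S (\<Delta> h) (\<lambda>h1 h2. S \<mu> (\<lambda>k l. f g (k \<cdot> h1) (l \<cdot> h2))))"
proof -
  note s = vector_space_scale
  obtain L where L: "Vector_Spaces.linear tscale s' L" "\<And>x y z. L (tensor (scale H) [x, y, z]) = f x y z"
    using trilin_lift[OF f] by blast
  have \<mu>: "\<mu> = S \<mu> (\<lambda>k l. tensor (scale H) [k, l])" by (simp add: ssum_tensor[OF s cocycle_in])
  have 1: "tensor_concat (scale H) \<mu> (tensor (scale H) [unit H]) = S \<mu> (\<lambda>k l. tensor (scale H) [k, l, unit H])"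
    by (subst \<mu>) (simp add: ssum_map[OF linear_tensor_concat_left[OF s]] tensor_concat_tensor[OF s])
  have 2: "tensor_concat (scale H) (tensor (scale H) [unit H]) \<mu> = S \<mu> (\<lambda>k l. tensor (scale H) [unit H, k, l])"
    by (subst \<mu>) (simp add: tensor_concat_ssum_right tensor_concat_tensor[OF s])
  have "L (tensor_mult H (tensor_concat (scale H) \<mu> (tensor (scale H) [unit H])) (comult_id H \<mu>))
      = L (tensor_mult H (tensor_concat (scale H) (tensor (scale H) [unit H]) \<mu>) (id_comult H \<mu>))"
    using two_cocycle by (simp add: two_cocycle_def)
  then show ?thesis
    by (simp add: 1 2 comult_id_ssum id_comult_ssum tensor_mult_ssum_left tensor_mult_ssum_right
        ssum_tensor_algebra tensor_mult_tensor[OF k_algebra] ssum_map[OF L(1)] L(2))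
qed

end

section \<open>Closure properties of bilinear and trilinear maps\<close>

lemma bilin_trilin:
  assumes "trilin s s' f"
  shows "bilin s s' (\<lambda>y z. f c y z)" "bilin s s' (\<lambda>x y. f x y c)"
  by (intro bilinI trilinD[OF assms])+

lemma trilin_ssum:
  assumes "\<And>g h. trilin s s' (\<lambda>x y z. f g h x y z)"
  shows "trilin s s' (\<lambda>x y z. ssum s0 t (\<lambda>g h. f g h x y z))"
  by (intro trilinI linear_ssum trilinD[OF assms])

lemma bilin_ssum:
  assumes "\<And>g h. bilin s s' (\<lambda>x y. f g h x y)"
  shows "bilin s s' (\<lambda>x y. ssum s0 t (\<lambda>g h. f g h x y))"
  by (intro bilinI linear_ssum bilinD[OF assms])

context k_alg
begin

lemma trilin_mult_left:
  assumes "trilin (scale H) s' f"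
  shows "trilin (scale H) s' (\<lambda>x y z. f (mult H u x) (mult H v y) (mult H w z))"
  by (intro trilinI linear_comp[OF linear_mult_right] trilinD[OF assms])

lemma trilin_mult_right:
  assumes "trilin (scale H) s' f"
  shows "trilin (scale H) s' (\<lambda>x y z. f (mult H x u) (mult H y v) (mult H z w))"
  by (intro trilinI linear_comp[OF linear_mult_left] trilinD[OF assms])

lemma bilin_mult_left:
  assumes "bilin (scale H) s' f"
  shows "bilin (scale H) s' (\<lambda>x y. f (mult H u x) (mult H v y))"
  by (intro bilinI linear_comp[OF linear_mult_right] bilinD[OF assms])

lemma bilin_mult_right:
  assumes "bilin (scale H) s' f"
  shows "bilin (scale H) s' (\<lambda>x y. f (mult H x u) (mult H y v))"
  by (intro bilinI linear_comp[OF linear_mult_left] bilinD[OF assms])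

end

context hopf
begin

lemma linear_ssum_comult:
  assumes "bilin (scale H) s' f"
  shows "lin s' (\<lambda>z. S (\<Delta> z) f)"
  by (rule linear_ssum_index[OF linear_comult comult_in assms])

end

context hopf_cocycle
begin

text \<open>The element (\<mu> \<otimes> 1) (\<Delta> \<otimes> id)(\<mu>) has the right inverse
  (\<Delta> \<otimes> id)(\<nu>) (\<nu> \<otimes> 1): multiplicativity of \<Delta> cancels the two
  inner factors, after which \<mu> \<nu> = 1 cancels the outer ones.\<close>

lemma cocycle_right_inverse:
  assumes f: "trilin (scale H) s' f"
  shows "S \<nu> (\<lambda>u v. S (\<Delta> u) (\<lambda>u1 u2. S \<nu> (\<lambda>p q.
      S \<mu> (\<lambda>g h. S (\<Delta> g) (\<lambda>g1 g2. S \<mu> (\<lambda>k l.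
        f ((k \<cdot> g1) \<cdot> (u1 \<cdot> p)) ((l \<cdot> g2) \<cdot> (u2 \<cdot> q)) (h \<cdot> v)))))))
    = f (unit H) (unit H) (unit H)"
proof -
  \<comment> \<open>\<open>F\<close> absorbs the outer factors \<mu> \<otimes> 1 and \<nu> \<otimes>
    1, so that only the two inner factors remain to be multiplied.\<close>
  define F where "F x y z = S \<nu> (\<lambda>p q. S \<mu> (\<lambda>k l. f (k \<cdot> x \<cdot> p) (l \<cdot> y \<cdot> q) z))" for x y z
  have F: "trilin (scale H) s' F"
    unfolding F_def
    by (intro trilin_ssum trilinI linear_comp[OF linear_comp[OF linear_mult_right linear_mult_left]]
        trilinD[OF f])
  have B: "bilin (scale H) s' (\<lambda>x z. S (\<Delta> x) (\<lambda>x1 x2. F x1 x2 z))"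
    by (intro bilinI linear_ssum_comult linear_ssum trilinD[OF F] bilin_trilin[OF F])
  have "S \<nu> (\<lambda>p q. S \<mu> (\<lambda>g h. S (\<Delta> g) (\<lambda>g1 g2. S \<mu> (\<lambda>k l.
        f ((k \<cdot> g1) \<cdot> (u1 \<cdot> p)) ((l \<cdot> g2) \<cdot> (u2 \<cdot> q)) (h \<cdot> v)))))
      = S \<mu> (\<lambda>g h. S (\<Delta> g) (\<lambda>g1 g2. F (g1 \<cdot> u1) (g2 \<cdot> u2) (h \<cdot> v)))" for u1 u2 v
    unfolding F_def ssum_rotate[where t'' = \<nu>] by (simp only: mult_assoc)
  then have "?thesis \<longleftrightarrow> S \<nu> (\<lambda>u v. S (\<Delta> u) (\<lambda>u1 u2. S \<mu> (\<lambda>g h. S (\<Delta> g) (\<lambda>g1 g2.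
      F (g1 \<cdot> u1) (g2 \<cdot> u2) (h \<cdot> v))))) = f (unit H) (unit H) (unit H)"
    by simp
  also have "S \<nu> (\<lambda>u v. S (\<Delta> u) (\<lambda>u1 u2. S \<mu> (\<lambda>g h. S (\<Delta> g) (\<lambda>g1 g2.
      F (g1 \<cdot> u1) (g2 \<cdot> u2) (h \<cdot> v)))))
    = S \<mu> (\<lambda>g h. S \<nu> (\<lambda>u v. S (\<Delta> u) (\<lambda>u1 u2. S (\<Delta> g) (\<lambda>g1 g2.
      F (g1 \<cdot> u1) (g2 \<cdot> u2) (h \<cdot> v)))))"
    by (rule ssum_rotate)
  also have "\<dots> = S \<mu> (\<lambda>g h. S \<nu> (\<lambda>u v. S (\<Delta> g) (\<lambda>g1 g2. S (\<Delta> u) (\<lambda>u1 u2.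
      F (g1 \<cdot> u1) (g2 \<cdot> u2) (h \<cdot> v)))))"
  proof -
    have "S (\<Delta> u) (\<lambda>u1 u2. S (\<Delta> g) (\<lambda>g1 g2. F (g1 \<cdot> u1) (g2 \<cdot> u2) (h \<cdot> v)))
      = S (\<Delta> g) (\<lambda>g1 g2. S (\<Delta> u) (\<lambda>u1 u2. F (g1 \<cdot> u1) (g2 \<cdot> u2) (h \<cdot> v)))" for u v g h
      by (rule ssum_swap)
    then show ?thesis by simp
  qed
  also have "\<dots> = S \<mu> (\<lambda>g h. S \<nu> (\<lambda>u v. S (\<Delta> (g \<cdot> u)) (\<lambda>x1 x2. F x1 x2 (h \<cdot> v))))"
    by (simp add: ssum_comult_mult[OF bilin_trilin(2)[OF F]])
  also have "\<dots> = F (unit H) (unit H) (unit H)"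
    by (simp add: ssum_cocycle_inverse(1)[OF B] ssum_comult_unit[OF bilin_trilin(2)[OF F]])
  also have "\<dots> = f (unit H) (unit H) (unit H)"
    unfolding F_def using ssum_cocycle_inverse(1)[OF bilin_trilin(2)[OF f]]
    by (simp add: ssum_swap[of _ \<nu> _ \<mu>])
  finally show ?thesis by simp
qed

end

section \<open>The twisted product\<close>

locale twist = hopf_cocycle H \<mu> for H :: "('k::field, 'h::ab_group_add) hopf_alg" and \<mu> +
  fixes A :: "('k, 'a::ab_group_add) alg" and act :: "'h \<Rightarrow> 'a \<Rightarrow> 'a"
  assumes module_algebra: "module_algebra H A act"
begin

sublocale A: k_alg A
  using module_algebra by unfold_locales (simp add: module_algebra_def)

abbreviation "sA \<equiv> scale A"
abbreviation amult (infixl "**" 70) where "a ** b \<equiv> mult A a b"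

lemma linear_act: "Vector_Spaces.linear sA sA (\<lambda>a. act h a)"
  and linear_act_index: "lin sA (\<lambda>h. act h a)"
  and act_unit [simp]: "act (unit H) a = a"
  and act_mult: "act (g \<cdot> h) a = act g (act h a)"
  and act_one: "act h (unit A) = sA (\<epsilon> h) (unit A)"
  using module_algebra by (auto simp: module_algebra_def hopf_module_def)

definition act2 :: "'h \<Rightarrow> 'h \<Rightarrow> ('a, 'k) tensor \<Rightarrow> ('a, 'k) tensor" where
  "act2 g h = bilinear_lift sA tscale (\<lambda>a b. tensor sA [act g a, act h b])"

lemma linear_tensor_act_slots:
  "Vector_Spaces.linear sA tscale (\<lambda>b. tensor sA [act g a, act h b])"
  "Vector_Spaces.linear sA tscale (\<lambda>a. tensor sA [act g a, act h b])"
  using bilinD[OF bilin_tensor[OF A.vector_space_scale]] by (intro linear_comp[OF linear_act]; blast)+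

lemma linear_act2: "Vector_Spaces.linear tscale tscale (act2 g h)"
  and act2_tensor [simp]: "act2 g h (tensor sA [a, b]) = tensor sA [act g a, act h b]"
  unfolding act2_def
  by (rule linear_bilinear_lift bilinear_lift_tensor; rule linear_tensor_act_slots)+

text \<open>The default value of \<open>bilinear_lift\<close>. It lets
  \<open>tensor_act_ssum\<close> be proved for tensors of all degrees at once.\<close>

lemma act2_tensor_0: "length xs \<noteq> 2 \<Longrightarrow> act2 g h (tensor sA xs) = 0"
  using tensor_lift_tensor[OF multilinear_bilinear[OF linear_tensor_act_slots]]
  by (auto simp: act2_def bilinear_lift_def split: list.splits)

lemma tensor_act_ssum:
  assumes t: "t \<in> tensor_power (scale H) 2 UNIV" and x: "x \<in> tensor_algebra sA UNIV"
  shows "tensor_act H sA act t x = S t (\<lambda>g h. act2 g h x)"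
proof -
  have "bilin (scale H) tscale (\<lambda>g h. act2 g h x)"
    using x
  proof (induction rule: tensor_algebra_induct)
    case subspace
    show ?case
      using linear_zero_fun[OF vector_space_scale vector_space_tscale]
      by (intro tens.subspaceI CollectI bilinI)
        (auto simp: linear_0[OF linear_act2] linearD(3,4)[OF linear_act2]
          intro!: linear_add_fun linear_scale_fun dest: bilinD)
  next
    case (tensor xs)
    note t = bilinD[OF bilin_tensor[OF A.vector_space_scale]]
    show ?case
    proof (cases "length xs = 2")
      case True
      then obtain a b where "xs = [a, b]" by (auto simp: length_Suc_conv numeral_2_eq_2)
      then show ?thesis
        using linear_comp[OF linear_act_index t(1)] linear_comp[OF linear_act_index t(2)]
        by (intro bilinI) simp_all
    qed (use linear_zero_fun[OF vector_space_scale vector_space_tscale] in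
        \<open>auto simp: act2_tensor_0 intro: bilinI\<close>)
  qed
  then show ?thesis
    unfolding tensor_act_def act2_def[symmetric] by (rule ssum_bilinear_lift[OF _ t, symmetric])
qed

lemma bilin_mult: "bilin sA sA (\<lambda>a b. a ** b)"
  by (intro bilinI A.linear_mult_left A.linear_mult_right)

lemma mult_map_tensor_act:
  assumes "t \<in> tensor_power (scale H) 2 UNIV"
  shows "mult_map A (tensor_act H sA act t (tensor sA [a, b])) = S t (\<lambda>g h. act g a ** act h b)"
  unfolding mult_map_def
  by (simp add: tensor_act_ssum[OF assms] ssum_map[OF linear_bilinear_lift[OF bilinD[OF bilin_mult]]]
      bilinear_lift_tensor[OF bilinD[OF bilin_mult]])

lemma act_amult: "act h (a ** b) = S (\<Delta> h) (\<lambda>g k. act g a ** act k b)"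
  using module_algebra by (simp add: module_algebra_def mult_map_tensor_act)

definition tmult (infixl "\<star>" 70) where "a \<star> b = S \<nu> (\<lambda>g h. act g a ** act h b)"

lemma bilin_tmult: "bilin sA sA (\<lambda>a b. a \<star> b)"
  unfolding tmult_def
  by (intro bilin_ssum bilinI linear_comp[OF linear_act] bilinD[OF bilin_mult])

lemmas linear_tmult = bilinD[OF bilin_tmult]

text \<open>Since \<nu> \<mu> = 1, letting \<mu> act first cancels the \<nu> in the twisted product.
  Later arguments use this form, which leads from the known product to the new one.\<close>

lemma amult_eq: "a ** b = S \<mu> (\<lambda>g h. act g a \<star> act h b)"
proof -
  have b: "bilin (scale H) sA (\<lambda>x y. act x a ** act y b)"
    by (intro bilinI linear_comp[OF linear_act_index] bilinD[OF bilin_mult])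
  show ?thesis
    using ssum_cocycle_inverse(2)[OF b]
    by (simp add: tmult_def act_mult[symmetric] ssum_swap[of _ \<mu> _ \<nu>])
qed

text \<open>\<open>H\<close> acts on the unit through the counit, so writing
  \<open>unit A ** a\<close> by \<open>amult_eq\<close> applies the counit to one leg of \<mu>, and
  counitality removes the sum.\<close>

lemma tmult_unit: "unit A \<star> a = a" "a \<star> unit A = a"
proof -
  have "a = unit A ** a" by simp
  also have "\<dots> = S \<mu> (\<lambda>g h. sA (\<epsilon> g) (unit A \<star> act h a))"
    by (simp only: amult_eq act_one linearD(4)[OF linear_tmult(2)])
  also have "\<dots> = unit A \<star> a"
    by (subst counital_ssum(1)) (simp_all add: linear_comp[OF linear_act_index linear_tmult(1)])
  finally show "unit A \<star> a = a" ..
  have "a = a ** unit A" by simp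
  also have "\<dots> = S \<mu> (\<lambda>g h. sA (\<epsilon> h) (act g a \<star> unit A))"
    by (simp only: amult_eq act_one linearD(4)[OF linear_tmult(1)])
  also have "\<dots> = a \<star> unit A"
    by (subst counital_ssum(2)) (simp_all add: linear_comp[OF linear_act_index linear_tmult(2)])
  finally show "a \<star> unit A = a" ..
qed

text \<open>Both bracketings of the original product are obtained by letting the same element
  \<open>(\<mu> \<otimes> 1)(\<triangle> \<otimes> id)(\<mu>)\<close> of \<open>H \<otimes> H \<otimes> H\<close> act before the respective bracketings of the
  twisted product; this element has a right inverse.\<close>

lemma tmult_assoc: "(a \<star> b) \<star> c = a \<star> (b \<star> c)"
proof -
  define f where "f a b c x y z = (act x a \<star> act y b) \<star> act z c" for a b c x y z
  define f' where "f' a b c x y z = act x a \<star> (act y b \<star> act z c)" for a b c x y z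
  have f: "trilin (scale H) sA (f a b c)" for a b c
    unfolding f_def by (intro trilinI linear_comp[OF linear_act_index]
        linear_comp[OF linear_tmult(1) linear_tmult(2)] linear_comp[OF linear_tmult(2) linear_tmult(2)]
        linear_tmult)
  have f': "trilin (scale H) sA (f' a b c)" for a b c
    unfolding f'_def by (intro trilinI linear_comp[OF linear_act_index]
        linear_comp[OF linear_tmult(1) linear_tmult(1)] linear_comp[OF linear_tmult(2) linear_tmult(1)]
        linear_tmult)
  let ?X = "\<lambda>f. S \<mu> (\<lambda>g h. S (\<Delta> g) (\<lambda>g1 g2. S \<mu> (\<lambda>k l. f (k \<cdot> g1) (l \<cdot> g2) h)))"
  \<comment> \<open>Each side is a bracketing of the triple product in \<open>A\<close>. For the
    right bracketing \<mu> enters in its other form, which the cocycle identity converts.\<close>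
  have X: "?X (f a b c) = ?X (f' a b c)" for a b c
  proof -
    have "?X (f a b c) = (a ** b) ** c"
      by (simp add: amult_eq[of "a ** b" c] act_amult amult_eq[of "act _ a"] f_def act_mult
          ssum_map[OF linear_tmult(2)])
    also have "\<dots> = a ** (b ** c)" by (rule A.mult_assoc)
    also have "\<dots> = S \<mu> (\<lambda>g h. S (\<Delta> h) (\<lambda>h1 h2. S \<mu> (\<lambda>k l. f' a b c g (k \<cdot> h1) (l \<cdot> h2))))"
      by (simp add: amult_eq[of a "b ** c"] act_amult amult_eq[of "act _ b"] f'_def act_mult
          ssum_map[OF linear_tmult(1)])
    also have "\<dots> = ?X (f' a b c)" by (rule cocycle[OF f', symmetric])
    finally show ?thesis .
  qed
  \<comment> \<open>The right-hand factors act first and can be moved onto \<open>a\<close>,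
    \<open>b\<close>, \<open>c\<close>. Hence \<open>X\<close>, valid for all arguments, applies
    underneath the sums of the right inverse.\<close>
  have sf: "f a b c (x \<cdot> x') (y \<cdot> y') (z \<cdot> z') = f (act x' a) (act y' b) (act z' c) x y z"
    and sf': "f' a b c (x \<cdot> x') (y \<cdot> y') (z \<cdot> z') = f' (act x' a) (act y' b) (act z' c) x y z"
    for x x' y y' z z'
    by (simp_all add: f_def f'_def act_mult)
  have "(a \<star> b) \<star> c = f a b c (unit H) (unit H) (unit H)" by (simp add: f_def)
  also have "\<dots> = f' a b c (unit H) (unit H) (unit H)"
    unfolding cocycle_right_inverse[OF f, symmetric] cocycle_right_inverse[OF f', symmetric] sf sf' X ..
  also have "\<dots> = a \<star> (b \<star> c)" by (simp add: f'_def)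
  finally show ?thesis .
qed

abbreviation "B \<equiv> drinfeld_twist H A act \<mu>"

lemma drinfeld_twist_simps [simp]: "scale B = sA" "unit B = unit A" "mult B a b = a \<star> b"
  by (simp_all add: drinfeld_twist_def mult_map_tensor_act tmult_def flip: \<nu>_def)

sublocale B: k_alg B
  by unfold_locales (simp add: k_algebra_def A.vector_space_scale linear_tmult tmult_unit tmult_assoc)

end

context twist
begin

section \<open>Lifting the action to the tensor algebra\<close>

abbreviation "TA \<equiv> tensor_algebra sA UNIV"
abbreviation tcat (infixl "\<odot>" 70) where "x \<odot> y \<equiv> tensor_concat sA x y"

lemmas linear_tcat_left = linear_tensor_concat_left[OF A.vector_space_scale]
  and linear_tcat_right = linear_tensor_concat_right[OF A.vector_space_scale]
  and tcat_add_right = tensor_concat_add_right[OF A.vector_space_scale]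
  and tcat_scale_right = tensor_concat_scale_right[OF A.vector_space_scale]
  and tcat_closed = tensor_concat_closed[OF A.vector_space_scale]
  and tcat_assoc = tensor_concat_assoc[OF A.vector_space_scale]
  and tcat_tensor = tensor_concat_tensor[OF A.vector_space_scale]

lemma tcat_0_right: "x \<in> TA \<Longrightarrow> x \<odot> 0 = 0"
  using tcat_add_right[OF _ tensor_algebra_0 tensor_algebra_0, of x] by simp

lemma tcat_ssum_left: "y \<in> TA \<Longrightarrow> ssum s t f \<odot> y = ssum s t (\<lambda>g h. f g h \<odot> y)"
  by (rule ssum_map[OF linear_tcat_left])

lemma tcat_ssum_right: "x \<in> TA \<Longrightarrow> (\<And>g h. f g h \<in> TA) \<Longrightarrow> x \<odot> ssum s t f = ssum s t (\<lambda>g h. x \<odot> f g h)"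
  by (rule ssum_map_on[where S = TA])
    (simp_all add: tensor_algebra_0 tensor_algebra_add tcat_add_right tcat_0_right)

lemma ssum_tscale: "tscale c (ssum s t f) = ssum s t (\<lambda>g h. tscale c (f g h))"
  by (rule ssum_map[of tscale tscale])
    (intro linearI vector_space_tscale; simp add: tens.scale_right_distrib tens.scale_left_commute)

text \<open>For \<open>c = 1 \<otimes> 1\<close> this is the diagonal action of \<open>h\<close> on \<open>x1 \<otimes> \<dots> \<otimes> xn\<close>; for \<open>c = \<mu>\<close> it is
  this action followed by the map \<open>\<Psi>\<close> with \<open>\<Psi> (a \<otimes> x) = \<Sum> (\<mu>\<^sub>1 \<rhd> a) \<otimes> \<Psi> (\<mu>\<^sub>2 \<rhd> x)\<close>,
  an isomorphism from the twist of the tensor algebra to the tensor algebra.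
  Merging the two into one function keeps the recursion structural.\<close>

primrec qact_list :: "('h, 'k) tensor \<Rightarrow> 'a list \<Rightarrow> 'h \<Rightarrow> ('a, 'k) tensor" where
  "qact_list c [] = (\<lambda>h. tscale (\<epsilon> h) (tensor sA []))"
| "qact_list c (a # xs) = (\<lambda>h. S (\<Delta> h) (\<lambda>x y. S c (\<lambda>g k.
      tensor sA [act (g \<cdot> x) a] \<odot> qact_list c xs (k \<cdot> y))))"

definition qact :: "('h, 'k) tensor \<Rightarrow> 'h \<Rightarrow> ('a, 'k) tensor \<Rightarrow> ('a, 'k) tensor" where
  "qact c h = tensor_lift sA tscale (\<lambda>xs. qact_list c xs h)"

text \<open>Used with \<open>V = G 1\<close> for the generating space, and with \<open>UNIV\<close>
  for the ambient tensor algebra.\<close>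

definition stable :: "'a set \<Rightarrow> bool" where
  "stable V \<longleftrightarrow> (\<forall>h. \<forall>a\<in>V. act h a \<in> V)"

lemma stable_UNIV [simp]: "stable UNIV"
  by (simp add: stable_def)

lemma qact_list_closed:
  assumes "stable V" "xs \<in> lists V"
  shows "qact_list c xs h \<in> tensor_algebra sA V"
  using assms(2)
  by (induction xs arbitrary: h)
    (use assms(1) in \<open>auto simp: stable_def
      intro!: ssum_tensor_algebra tcat_closed tensor_in_algebra tensor_algebra_scale\<close>)

lemma qact_list_in [simp]: "qact_list c xs h \<in> TA"
  by (rule qact_list_closed) simp_all

lemma linear_act_tcat:
  assumes "z \<in> TA"
  shows "Vector_Spaces.linear sA tscale (\<lambda>a. tensor sA [a] \<odot> z)"
  using linear_comp[OF _ linear_tcat_left[OF assms]] linear_tensor_slot[OF A.vector_space_scale, of "[]" "[]"]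
  by simp

lemma bilin_act_tcat:
  assumes "lin tscale f" "\<And>y. f y \<in> TA"
  shows "bilin (scale H) tscale (\<lambda>x y. tensor sA [act x a] \<odot> f y)"
  using linear_comp[OF linear_act_index linear_act_tcat[OF assms(2)]]
  by (intro bilinI linear_tcat_right assms) simp_all

lemma linear_qact_list: "lin tscale (\<lambda>h. qact_list c xs h)"
proof (induction xs)
  case Nil
  then show ?case by (simp add: linear_scaled_vector[OF linear_counit vector_space_tscale])
next
  case (Cons a xs)
  then show ?case
    by (simp, intro linear_ssum_comult bilin_ssum bilin_mult_left bilin_act_tcat) simp_all
qed

lemma multilinear_qact_list: "multilinear sA tscale (\<lambda>xs. qact_list c xs h)"
  unfolding multilinear_def
proof (intro allI)
  fix us vs
  show "Vector_Spaces.linear sA tscale (\<lambda>x. qact_list c (us @ x # vs) h)"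
  proof (induction us arbitrary: h)
    case Nil
    show ?case
      by (simp, intro linear_ssum linear_comp[OF linear_act linear_act_tcat] qact_list_in)
  next
    case (Cons a us)
    then show ?case by (simp, intro linear_ssum linear_tcat_right) simp_all
  qed
qed

lemmas linear_qact = linear_tensor_lift[OF multilinear_qact_list, folded qact_def]
  and qact_tensor = tensor_lift_tensor[OF multilinear_qact_list, folded qact_def]

lemma qact_closed:
  assumes "stable V" "x \<in> tensor_algebra sA V"
  shows "qact c h x \<in> tensor_algebra sA V"
  using assms(2)
proof (induction rule: tensor_algebra_induct)
  case subspace
  show ?case by (rule linear_subspace_vimage[OF linear_qact subspace_tensor_algebra])
qed (simp add: qact_tensor qact_list_closed[OF assms(1)])

lemma qact_in [simp]: "x \<in> TA \<Longrightarrow> qact c h x \<in> TA"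
  by (rule qact_closed) simp_all

lemma linear_qact_index:
  assumes "x \<in> TA"
  shows "lin tscale (\<lambda>h. qact c h x)"
  using assms
proof (induction rule: tensor_algebra_induct)
  case subspace
  show ?case
    using linear_zero_fun[OF vector_space_scale vector_space_tscale]
    by (intro tens.subspaceI CollectI)
      (auto simp: linear_0[OF linear_qact] linearD(3,4)[OF linear_qact]
        intro!: linear_add_fun linear_scale_fun)
qed (simp add: qact_tensor linear_qact_list)

text \<open>Both sides are linear in \<open>x\<close>, so the defining recursion on lists carries
  over to all tensors.\<close>

lemma qact_cons:
  assumes "x \<in> TA"
  shows "qact c h (tensor sA [a] \<odot> x)
    = S (\<Delta> h) (\<lambda>y z. S c (\<lambda>g k. tensor sA [act (g \<cdot> y) a] \<odot> qact c (k \<cdot> z) x))"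
  using assms
  by (induction rule: tensor_algebra_induct_on)
    (simp_all add: tcat_0_right tcat_add_right tcat_scale_right linear_0[OF linear_qact]
      linearD(3,4)[OF linear_qact] ssum_add ssum_tscale tcat_tensor qact_tensor)

lemma qact_nil: "qact c h (tensor sA []) = tscale (\<epsilon> h) (tensor sA [])"
  by (simp add: qact_tensor)

section \<open>The diagonal action and the map \<Psi>\<close>

abbreviation "dact \<equiv> qact (tensor (scale H) [unit H, unit H])"
abbreviation "\<Psi> \<equiv> qact \<mu>"

lemma dact_cons:
  assumes "x \<in> TA"
  shows "dact h (tensor sA [a] \<odot> x) = S (\<Delta> h) (\<lambda>y z. tensor sA [act y a] \<odot> dact z x)"
proof -
  have "bilin (scale H) tscale (\<lambda>y z. tensor sA [act y a] \<odot> dact z x)"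
    by (intro bilin_act_tcat linear_qact_index qact_in assms)
  note ssum_pure[OF bilin_mult_right[OF this]]
  then show ?thesis unfolding qact_cons[OF assms] by simp
qed

lemma tensor_Cons: "tensor sA (a # xs) = tensor sA [a] \<odot> tensor sA xs"
  by (simp add: tcat_tensor)

text \<open>At each step of the recursion, multiplicativity of \<Delta> merges the legs of
  \<open>k\<close> and \<open>h\<close>. With \<open>k = unit H\<close> it shows that
  \<open>\<Psi> h\<close> is the diagonal action of \<open>h\<close> followed by
  \<open>\<Psi> (unit H)\<close>.\<close>

lemma \<Psi>_mult:
  assumes "x \<in> TA"
  shows "\<Psi> (k \<cdot> h) x = \<Psi> k (dact h x)"
  using assms
proof (rule tensor_algebra_eqI)
  show "Vector_Spaces.linear tscale tscale (\<lambda>x. \<Psi> (k \<cdot> h) x)"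
    "Vector_Spaces.linear tscale tscale (\<lambda>x. \<Psi> k (dact h x))"
    by (intro linear_qact linear_comp[OF linear_qact linear_qact])+
  fix xs :: "'a list"
  show "\<Psi> (k \<cdot> h) (tensor sA xs) = \<Psi> k (dact h (tensor sA xs))"
  proof (induction xs arbitrary: h k)
    case Nil
    then show ?case by (simp add: qact_nil linearD(4)[OF linear_qact])
  next
    case (Cons a xs)
    have b: "bilin (scale H) tscale (\<lambda>y z. S \<mu> (\<lambda>g l. tensor sA [act (g \<cdot> y) a] \<odot> \<Psi> (l \<cdot> z) (tensor sA xs)))"
      by (intro bilin_ssum bilin_mult_left bilin_act_tcat linear_qact_index qact_in A.tensor_in)
    have "\<Psi> k (dact h (tensor sA (a # xs)))
      = S (\<Delta> h) (\<lambda>h1 h2. S (\<Delta> k) (\<lambda>k1 k2. S \<mu> (\<lambda>g l.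
          tensor sA [act (g \<cdot> (k1 \<cdot> h1)) a] \<odot> \<Psi> (l \<cdot> (k2 \<cdot> h2)) (tensor sA xs))))"
      unfolding tensor_Cons[of a xs]
      by (simp add: dact_cons qact_cons[of _ \<mu>] ssum_map[OF linear_qact] Cons.IH[symmetric]
          act_mult mult_assoc)
    also have "\<dots> = S (\<Delta> k) (\<lambda>k1 k2. S (\<Delta> h) (\<lambda>h1 h2. S \<mu> (\<lambda>g l.
          tensor sA [act (g \<cdot> (k1 \<cdot> h1)) a] \<odot> \<Psi> (l \<cdot> (k2 \<cdot> h2)) (tensor sA xs))))"
      by (rule ssum_swap)
    also have "\<dots> = \<Psi> (k \<cdot> h) (tensor sA (a # xs))"
      unfolding tensor_Cons[of a xs] by (simp add: qact_cons ssum_comult_mult[OF b])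
    finally show ?case ..
  qed
qed

lemma \<Psi>_unit_cons:
  assumes "x \<in> TA"
  shows "\<Psi> (unit H) (tensor sA [a] \<odot> x) = S \<mu> (\<lambda>g k. tensor sA [act g a] \<odot> \<Psi> k x)"
proof -
  have "bilin (scale H) tscale (\<lambda>y z. S \<mu> (\<lambda>g l. tensor sA [act (g \<cdot> y) a] \<odot> \<Psi> (l \<cdot> z) x))"
    by (intro bilin_ssum bilin_mult_left bilin_act_tcat linear_qact_index qact_in assms)
  then show ?thesis by (simp add: qact_cons[OF assms] ssum_comult_unit)
qed

text \<open>Induction on the length of a pure \<open>x\<close>, with \<open>h\<close> arbitrary
  because the recursion shifts legs into it. Splitting off the first entry produces (1 \<otimes>
  \<mu>) (id \<otimes> \<Delta>)(\<mu>); the cocycle identity turns this into (\<mu> \<otimes> 1)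
  (\<Delta> \<otimes> id)(\<mu>), and coassociativity regroups the legs of \<open>h\<close> to
  match.\<close>

lemma \<Psi>_concat:
  assumes x: "x \<in> TA" and y: "y \<in> TA"
  shows "\<Psi> h (x \<odot> y) = S (\<Delta> h) (\<lambda>p q. S \<mu> (\<lambda>g k. \<Psi> (g \<cdot> p) x \<odot> \<Psi> (k \<cdot> q) y))"
  using x
proof (rule tensor_algebra_eqI)
  show "Vector_Spaces.linear tscale tscale (\<lambda>x. \<Psi> h (x \<odot> y))"
    by (intro linear_comp[OF linear_tcat_left linear_qact] y)
  show "Vector_Spaces.linear tscale tscale
      (\<lambda>x. S (\<Delta> h) (\<lambda>p q. S \<mu> (\<lambda>g k. \<Psi> (g \<cdot> p) x \<odot> \<Psi> (k \<cdot> q) y)))"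
    by (intro linear_ssum linear_comp[OF linear_qact linear_tcat_left] qact_in y)
  fix xs :: "'a list"
  show "\<Psi> h (tensor sA xs \<odot> y)
      = S (\<Delta> h) (\<lambda>p q. S \<mu> (\<lambda>g k. \<Psi> (g \<cdot> p) (tensor sA xs) \<odot> \<Psi> (k \<cdot> q) y))"
  proof (induction xs arbitrary: h)
    case Nil
    have unit_left: "tensor sA [] \<odot> z = z" if "z \<in> TA" for z
      using that by (induction rule: tensor_algebra_induct_on)
        (simp_all add: tcat_0_right tcat_add_right tcat_scale_right tcat_tensor)
    note l = linear_qact_index[OF y]
    have "S (\<Delta> h) (\<lambda>p q. S \<mu> (\<lambda>g k. \<Psi> (g \<cdot> p) (tensor sA []) \<odot> \<Psi> (k \<cdot> q) y))
      = S (\<Delta> h) (\<lambda>p q. tscale (\<epsilon> p) (S \<mu> (\<lambda>g k. tscale (\<epsilon> g) (\<Psi> (k \<cdot> q) y))))"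
      using y by (simp add: qact_nil linearD(4)[OF linear_tcat_left] unit_left ssum_tscale mult.commute)
    also have "\<dots> = S (\<Delta> h) (\<lambda>p q. tscale (\<epsilon> p) (\<Psi> q y))"
      \<comment> \<open>Counitality removes \<mu> here; the counit axiom then removes the coproduct
        of \<open>h\<close>.\<close>
      using counital_ssum(1)[OF linear_comp[OF linear_mult_left l]] by simp
    also have "\<dots> = \<Psi> h y" by (rule counit_comult(1)[OF l])
    finally show ?case using y by (simp add: unit_left)
  next
    case (Cons a xs)
    define F where "F x1 x2 x3 = tensor sA [act x1 a] \<odot> (\<Psi> x2 (tensor sA xs) \<odot> \<Psi> x3 y)" for x1 x2 x3
    have F: "trilin (scale H) tscale F"
      unfolding F_def
      by (intro trilinI linear_comp[OF linear_act_index linear_act_tcat] linear_tcat_right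
          linear_comp[OF linear_qact_index linear_tcat_left] linear_qact_index qact_in tcat_closed y
          A.tensor_in)
    \<comment> \<open>\<open>G\<close> gathers the contribution of both copies of \<mu>, so that
      coassociativity need only treat the legs of \<open>h\<close>.\<close>
    define G where "G x z1 z2 = S \<mu> (\<lambda>g k. S (\<Delta> g) (\<lambda>g1 g2. S \<mu> (\<lambda>g' k'.
      F (g' \<cdot> g1 \<cdot> x) (k' \<cdot> g2 \<cdot> z1) (k \<cdot> z2))))" for x z1 z2
    have G: "trilin (scale H) tscale G"
      unfolding G_def by (intro trilin_ssum trilin_mult_left F)
    \<comment> \<open>The factors \<open>unit H\<close> are inserted only to give every slot the
      shape expected by \<open>trilin_mult_left\<close>; they are simplified away next.\<close>
    have "trilin (scale H) tscale (\<lambda>x y z. S \<mu> (\<lambda>g k. F (unit H \<cdot> x) (g \<cdot> y) (k \<cdot> z)))"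
      "trilin (scale H) tscale (\<lambda>x y z. S \<mu> (\<lambda>g k. F (g \<cdot> x) (k \<cdot> y) (unit H \<cdot> z)))"
      by (intro trilin_ssum trilin_mult_left F)+
    then have \<mu>F: "trilin (scale H) tscale (\<lambda>x y z. S \<mu> (\<lambda>g k. F x (g \<cdot> y) (k \<cdot> z)))"
      "trilin (scale H) tscale (\<lambda>x y z. S \<mu> (\<lambda>g k. F (g \<cdot> x) (k \<cdot> y) z))"
      by (simp_all only: mult_unit)
    have "\<Psi> h (tensor sA (a # xs) \<odot> y)
      = S (\<Delta> h) (\<lambda>x z. S \<mu> (\<lambda>g k. S (\<Delta> (k \<cdot> z)) (\<lambda>p q. S \<mu> (\<lambda>g' k'.
          F (g \<cdot> x) (g' \<cdot> p) (k' \<cdot> q)))))"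
      unfolding tensor_Cons[of a xs] using y
      by (simp add: tcat_assoc qact_cons tcat_closed Cons.IH tcat_ssum_right ssum_tensor_algebra F_def)
    also have "\<dots> = S (\<Delta> h) (\<lambda>x z. S \<mu> (\<lambda>g k. S (\<Delta> k) (\<lambda>k1 k2. S (\<Delta> z) (\<lambda>z1 z2.
        S \<mu> (\<lambda>g' k'. F (g \<cdot> x) (g' \<cdot> k1 \<cdot> z1) (k' \<cdot> k2 \<cdot> z2))))))"
      by (simp only: ssum_comult_mult[OF bilin_trilin(1)[OF \<mu>F(1)]] mult_assoc)
    also have "\<dots> = S (\<Delta> h) (\<lambda>x z. S (\<Delta> z) (\<lambda>z1 z2. G x z1 z2))"
    proof -
      have "S \<mu> (\<lambda>g k. S (\<Delta> k) (\<lambda>k1 k2. S (\<Delta> z) (\<lambda>z1 z2.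
          S \<mu> (\<lambda>g' k'. F (g \<cdot> x) (g' \<cdot> k1 \<cdot> z1) (k' \<cdot> k2 \<cdot> z2)))))
        = S (\<Delta> z) (\<lambda>z1 z2. G x z1 z2)" for x z
        unfolding G_def cocycle[OF trilin_mult_right[OF F]] by (rule ssum_rotate)
      then show ?thesis by (simp only:)
    qed
    also have "\<dots> = S (\<Delta> h) (\<lambda>x z. S (\<Delta> x) (\<lambda>x1 x2. G x1 x2 z))"
      by (rule coassoc[OF G, symmetric])
    also have "\<dots> = S (\<Delta> h) (\<lambda>x z. S \<mu> (\<lambda>g k. S (\<Delta> g) (\<lambda>g1 g2. S (\<Delta> x) (\<lambda>x1 x2. S \<mu> (\<lambda>g' k'.
      F (g' \<cdot> g1 \<cdot> x1) (k' \<cdot> g2 \<cdot> x2) (k \<cdot> z))))))"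
    proof -
      have "S (\<Delta> x) (\<lambda>x1 x2. G x1 x2 z) = S \<mu> (\<lambda>g k. S (\<Delta> g) (\<lambda>g1 g2. S (\<Delta> x) (\<lambda>x1 x2.
          S \<mu> (\<lambda>g' k'. F (g' \<cdot> g1 \<cdot> x1) (k' \<cdot> g2 \<cdot> x2) (k \<cdot> z)))))" for x z
        unfolding G_def by (rule ssum_rotate[symmetric])
      then show ?thesis by (simp only:)
    qed
    also have "\<dots> = S (\<Delta> h) (\<lambda>x z. S \<mu> (\<lambda>g k. S (\<Delta> (g \<cdot> x)) (\<lambda>p q. S \<mu> (\<lambda>g' k'.
      F (g' \<cdot> p) (k' \<cdot> q) (k \<cdot> z)))))"
      by (simp only: ssum_comult_mult[OF bilin_trilin(2)[OF \<mu>F(2)]] mult_assoc)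
    also have "\<dots> = S (\<Delta> h) (\<lambda>p q. S \<mu> (\<lambda>g k. \<Psi> (g \<cdot> p) (tensor sA (a # xs)) \<odot> \<Psi> (k \<cdot> q) y))"
      unfolding tensor_Cons[of a xs] using y
      by (simp add: tcat_assoc qact_cons tcat_closed tcat_ssum_left F_def)
    finally show ?case .
  qed
qed

text \<open>In degree one \<open>\<Psi> k\<close> is just the action of \<open>k\<close>, because
  counitality and the counit axiom remove both sums. One step of the recursion then leaves exactly
  the action of \<mu>.\<close>

lemma \<Psi>_tensor_act:
  assumes "x \<in> tensor_power sA 2 V"
  shows "\<Psi> (unit H) x = tensor_act H sA act \<mu> x"
proof -
  have \<Psi>1: "\<Psi> k (tensor sA [b]) = tensor sA [act k b]" for k b
  proof -
    have l: "lin tscale (\<lambda>k. tensor sA [act k b])"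
      using linear_comp[OF linear_act_index linear_tensor_slot[OF A.vector_space_scale, of "[]" "[]"]]
      by simp
    have "\<Psi> k (tensor sA [b] \<odot> tensor sA []) = S (\<Delta> k) (\<lambda>x y. S \<mu> (\<lambda>g l.
        tensor sA [act (g \<cdot> x) b] \<odot> \<Psi> (l \<cdot> y) (tensor sA [])))"
      by (rule qact_cons) simp
    also have "\<dots> = S (\<Delta> k) (\<lambda>x y. tscale (\<epsilon> y) (S \<mu> (\<lambda>g l. tscale (\<epsilon> l) (tensor sA [act (g \<cdot> x) b]))))"
      by (simp add: qact_nil tcat_scale_right tcat_tensor ssum_tscale mult.commute)
    also have "\<dots> = S (\<Delta> k) (\<lambda>x y. tscale (\<epsilon> y) (tensor sA [act x b]))"
      using counital_ssum(2)[OF linear_comp[OF linear_mult_left l]] by simp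
    also have "\<dots> = tensor sA [act k b]" by (rule counit_comult(2)[OF l])
    finally show ?thesis by (simp add: tcat_tensor)
  qed
  have "\<Psi> (unit H) x = S \<mu> (\<lambda>g h. act2 g h x)"
    using assms
  proof (induction rule: tensor_power_induct)
    case subspace
    show ?case by (intro linear_subspace_eq[of tscale] linear_qact linear_ssum linear_act2)
  next
    case (tensor xs)
    then obtain a b where "xs = [a, b]" by (auto simp: length_Suc_conv numeral_2_eq_2)
    moreover have "\<Psi> (unit H) (tensor sA [a] \<odot> tensor sA [b]) = S \<mu> (\<lambda>g h. tensor sA [act g a, act h b])"
      by (subst \<Psi>_unit_cons) (simp_all add: \<Psi>1 tcat_tensor)
    ultimately show ?case by (simp add: tcat_tensor)
  qed
  also have "x \<in> TA" using assms tensor_power_subset[of sA 2 V] tensor_algebra_UNIV[of x sA V] by blast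
  then have "S \<mu> (\<lambda>g h. act2 g h x) = tensor_act H sA act \<mu> x"
    by (rule tensor_act_ssum[OF cocycle_in, symmetric])
  finally show ?thesis .
qed

end

section \<open>Generated ideals and degrees\<close>

lemma tensor_ideal_algebra:
  assumes "vector_space s"
  shows "tensor_ideal s V (tensor_algebra s V)"
  using assms by (simp add: tensor_ideal_def subspace_tensor_algebra tensor_concat_closed)

text \<open>The hull is an intersection of ideals; it stays inside the tensor algebra because that
  algebra is itself a member of the family.\<close>

lemma tensor_ideal_generated:
  assumes s: "vector_space s" and R: "R \<subseteq> tensor_algebra s V"
  shows "tensor_ideal s V (generated_ideal s V R)"
proof -
  let ?F = "{I. tensor_ideal s V I \<and> R \<subseteq> I}"
  have "tensor_algebra s V \<in> ?F" using tensor_ideal_algebra[OF s] R by simp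
  then have "\<Inter>?F \<subseteq> tensor_algebra s V" by blast
  moreover have "module.subspace tscale (\<Inter>?F)"
    by (rule tens.subspace_Inter) (simp add: tensor_ideal_def)
  moreover have "\<forall>x\<in>\<Inter>?F. \<forall>y\<in>tensor_algebra s V. tensor_concat s x y \<in> \<Inter>?F \<and> tensor_concat s y x \<in> \<Inter>?F"
    unfolding tensor_ideal_def by blast
  ultimately show ?thesis by (simp add: generated_ideal_def hull_def tensor_ideal_def)
qed

lemma generated_ideal_superset: "R \<subseteq> generated_ideal s V R"
  by (simp add: generated_ideal_def hull_subset)

lemma generated_ideal_minimal: "R \<subseteq> I \<Longrightarrow> tensor_ideal s V I \<Longrightarrow> generated_ideal s V R \<subseteq> I"
  by (simp add: generated_ideal_def hull_minimal)

section \<open>Homogeneous components of tensors\<close>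

definition degree_part :: "('k::field \<Rightarrow> 'a::ab_group_add \<Rightarrow> 'a) \<Rightarrow> nat \<Rightarrow> ('a, 'k) tensor \<Rightarrow> ('a, 'k) tensor" where
  "degree_part s n = tensor_lift s tscale (\<lambda>xs. if length xs = n then tensor s xs else 0)"

lemma multilinear_degree_part:
  assumes "vector_space s"
  shows "multilinear s tscale (\<lambda>xs. if length xs = n then tensor s xs else 0)"
  unfolding multilinear_def
proof (intro allI)
  fix us vs
  show "Vector_Spaces.linear s tscale
      (\<lambda>x. if length (us @ x # vs) = n then tensor s (us @ x # vs) else 0)"
    using linear_tensor_slot[OF assms] linear_zero_fun[OF assms vector_space_tscale]
    by (cases "length us + Suc (length vs) = n") simp_all
qed

lemma
  assumes "vector_space s"
  shows linear_degree_part: "Vector_Spaces.linear tscale tscale (degree_part s n)"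
    and degree_part_tensor: "degree_part s n (tensor s xs) = (if length xs = n then tensor s xs else 0)"
  unfolding degree_part_def
  by (rule linear_tensor_lift tensor_lift_tensor; rule multilinear_degree_part[OF assms])+

lemma degree_part_in:
  assumes s: "vector_space s" and x: "x \<in> tensor_algebra s V"
  shows "degree_part s n x \<in> tensor_algebra s V"
  using x
proof (induction rule: tensor_algebra_induct)
  case subspace
  show ?case by (rule linear_subspace_vimage[OF linear_degree_part[OF s] subspace_tensor_algebra])
qed (simp add: degree_part_tensor[OF s] tensor_in_algebra tensor_algebra_0)

lemma degree_part_power:
  assumes s: "vector_space s" and x: "x \<in> tensor_power s m V"
  shows "degree_part s n x = (if m = n then x else 0)"
  using x
proof (induction rule: tensor_power_induct)
  case subspace
  show ?case
    by (rule tens.subspaceI)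
      (auto simp: linear_0[OF linear_degree_part[OF s]] linearD(3,4)[OF linear_degree_part[OF s]])
qed (simp add: degree_part_tensor[OF s])

lemma degree_part_concat_right:
  assumes s: "vector_space s" and x: "x \<in> tensor_algebra s UNIV"
  shows "degree_part s n (tensor_concat s x (tensor s vs)) =
    (if length vs \<le> n then tensor_concat s (degree_part s (n - length vs) x) (tensor s vs) else 0)"
  using x
proof (rule tensor_algebra_eqI)
  have v: "tensor s vs \<in> tensor_algebra s UNIV" by (simp add: tensor_in_algebra)
  note l = linear_degree_part[OF s] and c = linear_tensor_concat_left[OF s v]
  show "Vector_Spaces.linear tscale tscale (\<lambda>x. degree_part s n (tensor_concat s x (tensor s vs)))"
    by (rule linear_comp[OF c l])
  show "Vector_Spaces.linear tscale tscale (\<lambda>x. if length vs \<le> n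
      then tensor_concat s (degree_part s (n - length vs) x) (tensor s vs) else 0)"
    using linear_comp[OF l c] linear_zero_fun[OF vector_space_tscale vector_space_tscale]
    by (cases "length vs \<le> n") simp_all
qed (auto simp: tensor_concat_tensor[OF s] degree_part_tensor[OF s]
    linear_0[OF linear_tensor_concat_left[OF s]] tensor_in_algebra)

lemma degree_part_concat_left:
  assumes s: "vector_space s" and x: "x \<in> tensor_algebra s UNIV"
  shows "degree_part s n (tensor_concat s (tensor s vs) x) =
    (if length vs \<le> n then tensor_concat s (tensor s vs) (degree_part s (n - length vs) x) else 0)"
proof -
  have v: "tensor s vs \<in> tensor_algebra s UNIV" by (simp add: tensor_in_algebra)
  note a = tensor_concat_add_right[OF s v] tensor_concat_scale_right[OF s v]
  have z: "tensor_concat s (tensor s vs) 0 = 0"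
    using a(1)[OF tensor_algebra_0 tensor_algebra_0] by simp
  show ?thesis
    using x
    by (induction rule: tensor_algebra_induct_on)
      (auto simp: a z linear_0[OF linear_degree_part[OF s]] linearD(3,4)[OF linear_degree_part[OF s]]
        degree_part_in[OF s] tensor_concat_tensor[OF s] degree_part_tensor[OF s])
qed

text \<open>Concatenation is bilinear, so absorption has to be checked for pure tensors
  only.\<close>

lemma tensor_idealI:
  assumes s: "vector_space s" and I: "I \<subseteq> tensor_algebra s V" "module.subspace tscale I"
    and "\<And>x vs. x \<in> I \<Longrightarrow> vs \<in> lists V \<Longrightarrow> tensor_concat s x (tensor s vs) \<in> I"
    and "\<And>x vs. x \<in> I \<Longrightarrow> vs \<in> lists V \<Longrightarrow> tensor_concat s (tensor s vs) x \<in> I"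
  shows "tensor_ideal s V I"
proof -
  have "tensor_concat s x y \<in> I \<and> tensor_concat s y x \<in> I"
    if x: "x \<in> I" and y: "y \<in> tensor_algebra s V" for x y
  proof -
    have xT: "x \<in> tensor_algebra s UNIV" using x I(1) tensor_algebra_UNIV by blast
    note l = linear_tensor_concat_left[OF s xT]
      and r = tensor_concat_add_right[OF s xT] tensor_concat_scale_right[OF s xT]
    have r0: "tensor_concat s x 0 = 0" using r(1)[OF tensor_algebra_0 tensor_algebra_0] by simp
    show ?thesis
      using y
      by (induction rule: tensor_algebra_induct_on)
        (simp_all add: linear_0[OF l] linearD(3,4)[OF l] r r0 tensor_algebra_UNIV x assms(4,5)
          tens.subspace_0[OF I(2)] tens.subspace_add[OF I(2)] tens.subspace_scale[OF I(2)])
  qed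
  with I show ?thesis by (auto simp: tensor_ideal_def)
qed

text \<open>Multiplying by anything of positive degree pushes elements of \<open>R\<close> beyond
  degree two, so nothing new arises in degree two.\<close>

lemma generated_ideal_degree_two:
  assumes s: "vector_space s" and R: "module.subspace tscale R" "R \<subseteq> tensor_power s 2 V"
    and x: "x \<in> generated_ideal s V R" "x \<in> tensor_power s 2 V"
  shows "x \<in> R"
proof -
  note l = linear_degree_part[OF s]
  \<comment> \<open>An ideal containing \<open>R\<close> whose members have their degree-two part in
    \<open>R\<close>; minimality of the generated ideal puts \<open>x\<close> into it.\<close>
  define N where "N = {x \<in> tensor_algebra s V.
    degree_part s 0 x = 0 \<and> degree_part s 1 x = 0 \<and> degree_part s 2 x \<in> R}"
  have "tensor_ideal s V N"
  proof (rule tensor_idealI[OF s])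
    show "N \<subseteq> tensor_algebra s V" by (auto simp: N_def)
    show "module.subspace tscale N"
      unfolding N_def
      by (intro tens.subspaceI)
        (simp_all add: linear_0[OF l] linearD(3,4)[OF l] tens.subspace_0[OF R(1)]
          tens.subspace_add[OF R(1)] tens.subspace_scale[OF R(1)] tensor_algebra_0 tensor_algebra_add
          tensor_algebra_scale)
  next
    fix x and vs :: "'b list"
    assume x: "x \<in> N" and vs: "vs \<in> lists V"
    then have xT: "x \<in> tensor_algebra s UNIV" by (auto simp: N_def intro: tensor_algebra_UNIV)
    have v: "tensor s vs \<in> tensor_algebra s UNIV" "tensor s [] \<in> tensor_algebra s UNIV"
      by (simp_all add: tensor_in_algebra)
    have 0: "tensor_concat s (tensor s vs) 0 = 0" "tensor_concat s 0 (tensor s vs) = 0"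
      using tensor_concat_add_right[OF s v(1) tensor_algebra_0 tensor_algebra_0]
        linear_0[OF linear_tensor_concat_left[OF s v(1)]] by simp_all
    have unit: "tensor_concat s y (tensor s []) = y" "tensor_concat s (tensor s []) y = y"
      if "y \<in> tensor_algebra s UNIV" for y
    proof -
      note a = tensor_concat_add_right[OF s v(2)] tensor_concat_scale_right[OF s v(2)]
        linear_tensor_concat_left[OF s v(2)]
      have "tensor_concat s (tensor s []) 0 = 0"
        using a(1)[OF tensor_algebra_0 tensor_algebra_0] by simp
      with that show "tensor_concat s y (tensor s []) = y" "tensor_concat s (tensor s []) y = y"
        by (induction rule: tensor_algebra_induct_on)
          (simp_all add: a(1,2) linear_0[OF a(3)] linearD(3,4)[OF a(3)] tensor_concat_tensor[OF s])
    qed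
    have deg: "degree_part s 0 x = 0" "degree_part s 1 x = 0" "degree_part s 2 x \<in> R" "x \<in> tensor_algebra s V"
      using x by (simp_all add: N_def)
    have closed: "tensor_concat s x (tensor s vs) \<in> tensor_algebra s V"
      "tensor_concat s (tensor s vs) x \<in> tensor_algebra s V"
      using deg(4) vs by (simp_all add: tensor_concat_closed[OF s] tensor_in_algebra)
    have "tensor_concat s x (tensor s vs) \<in> N \<and> tensor_concat s (tensor s vs) x \<in> N"
    proof (cases "vs = []")
      case True
      then show ?thesis using x by (simp add: unit[OF xT])
    next
      case False
      then have "0 < length vs" by simp
      have "degree_part s n (tensor_concat s x (tensor s vs)) = 0"
        "degree_part s n (tensor_concat s (tensor s vs) x) = 0" if "n \<le> 2" for n
      proof -
        have "degree_part s (n - length vs) x = 0"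
        proof -
          \<comment> \<open>Natural subtraction truncates at 0, so this also covers lists longer
            than \<open>n\<close>.\<close>
          have "n - length vs = 0 \<or> n - length vs = 1" using that \<open>0 < length vs\<close> by linarith
          then show ?thesis using deg(1,2) by metis
        qed
        then show "degree_part s n (tensor_concat s x (tensor s vs)) = 0"
          "degree_part s n (tensor_concat s (tensor s vs) x) = 0"
          by (simp_all add: degree_part_concat_right[OF s xT] degree_part_concat_left[OF s xT] 0)
      qed
      then show ?thesis using closed tens.subspace_0[OF R(1)] by (simp add: N_def)
    qed
    then show "tensor_concat s x (tensor s vs) \<in> N" "tensor_concat s (tensor s vs) x \<in> N" by simp_all
  qed
  moreover have "R \<subseteq> N"
    using R(2) tensor_power_subset[of s 2 V] by (auto simp: N_def degree_part_power[OF s])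
  ultimately have "x \<in> N" using generated_ideal_minimal[of R N s V] x(1) by blast
  then show ?thesis using degree_part_power[OF s x(2)] by (simp add: N_def)
qed

lemma tensor_power_concat_cons:
  assumes s: "vector_space s" and a: "a \<in> V" and x: "x \<in> tensor_power s n V"
  shows "tensor_concat s (tensor s [a]) x \<in> tensor_power s (Suc n) V"
proof -
  have aT: "tensor s [a] \<in> tensor_algebra s UNIV" by (simp add: tensor_in_algebra)
  note r = tensor_concat_add_right[OF s aT] tensor_concat_scale_right[OF s aT]
  have r0: "tensor_concat s (tensor s [a]) 0 = 0"
    using r(1)[OF tensor_algebra_0 tensor_algebra_0] by simp
  have P: "module.subspace tscale (tensor_power s (Suc n) V)"
    by (simp add: tensor_power_def tens.subspace_span)
  have "x \<in> tensor_algebra s UNIV \<and> tensor_concat s (tensor s [a]) x \<in> tensor_power s (Suc n) V"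
    using x
  proof (induction rule: tensor_power_induct)
    case subspace
    show ?case
      by (intro tens.subspaceI)
        (simp_all add: r r0 tensor_algebra_0 tensor_algebra_add tensor_algebra_scale tens.subspace_0[OF P]
          tens.subspace_add[OF P] tens.subspace_scale[OF P])
  next
    case (tensor xs)
    then show ?case
      using a by (auto simp: tensor_concat_tensor[OF s] tensor_in_algebra tensor_power_def
          intro!: tens.span_base imageI)
  qed
  then show ?thesis ..
qed

lemma linear_subspace_image:
  assumes f: "Vector_Spaces.linear s s' f" and S: "module.subspace s S"
  shows "module.subspace s' (f ` S)"
proof -
  interpret Vector_Spaces.linear s s' f by fact
  show ?thesis by (rule subspace_image[OF S])
qed

section \<open>Canonical homomorphisms\<close>

lemma canonical_homD:
  assumes "canonical_hom A V \<phi>"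
  shows "Vector_Spaces.linear tscale (scale A) \<phi>" "\<phi> (tensor (scale A) []) = unit A"
    and "x \<in> tensor_algebra (scale A) V \<Longrightarrow> y \<in> tensor_algebra (scale A) V \<Longrightarrow>
      \<phi> (tensor_concat (scale A) x y) = mult A (\<phi> x) (\<phi> y)"
    and "v \<in> V \<Longrightarrow> \<phi> (tensor (scale A) [v]) = v"
  using assms by (auto simp: canonical_hom_def)

lemma canonical_hom_cons:
  assumes "canonical_hom A V \<phi>" "v \<in> V" "x \<in> tensor_algebra (scale A) V"
  shows "\<phi> (tensor_concat (scale A) (tensor (scale A) [v]) x) = mult A v (\<phi> x)"
  using assms by (simp add: canonical_homD tensor_in_algebra)

context k_alg
begin

text \<open>The product of the entries of a list is multilinear and sends \<open>@\<close> to
  multiplication, so its lift is multiplicative.\<close>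

lemma canonical_hom_exists: "\<exists>\<phi>. canonical_hom H V \<phi>"
proof -
  let ?f = "\<lambda>xs. foldr (mult H) xs (unit H)"
  note s = vector_space_scale
  have m: "multilinear (scale H) (scale H) ?f"
    unfolding multilinear_def
  proof (intro allI)
    fix us vs
    show "Vector_Spaces.linear (scale H) (scale H) (\<lambda>x. ?f (us @ x # vs))"
      by (induction us) (simp_all add: linear_mult_left linear_comp[OF _ linear_mult_right])
  qed
  define \<phi> where "\<phi> = tensor_lift (scale H) (scale H) ?f"
  have \<phi>: "Vector_Spaces.linear tscale (scale H) \<phi>" "\<And>xs. \<phi> (tensor (scale H) xs) = ?f xs"
    unfolding \<phi>_def by (rule linear_tensor_lift[OF m] tensor_lift_tensor[OF m])+
  have app: "foldr (mult H) us (?f vs) = mult H (?f us) (?f vs)" for us vs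
    by (induction us) (simp_all add: mult_assoc)
  note l = linear_tensor_concat_left[OF s] and mr = linear_mult_right and ml = linear_mult_left
  have pure: "\<phi> (tensor_concat (scale H) (tensor (scale H) us) y) = mult H (\<phi> (tensor (scale H) us)) (\<phi> y)"
    if "y \<in> tensor_algebra (scale H) UNIV" for us y
  proof -
    note r = tensor_concat_add_right[OF s tensor_in] tensor_concat_scale_right[OF s tensor_in]
    have r0: "tensor_concat (scale H) (tensor (scale H) us) 0 = 0"
      using r(1)[OF tensor_algebra_0 tensor_algebra_0] by simp
    show ?thesis
      using that by (induction rule: tensor_algebra_induct_on)
        (simp_all add: r r0 linear_0[OF \<phi>(1)] linearD(3,4)[OF \<phi>(1)] linear_0[OF mr]
          linearD(3,4)[OF mr] tensor_concat_tensor[OF s] \<phi>(2) app)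
  qed
  have "\<phi> (tensor_concat (scale H) x y) = mult H (\<phi> x) (\<phi> y)"
    if "x \<in> tensor_algebra (scale H) V" "y \<in> tensor_algebra (scale H) V" for x y
    using that(1)
    by (rule tensor_algebra_eqI[OF _ linear_comp[OF l \<phi>(1)] linear_comp[OF \<phi>(1) ml]])
      (simp_all add: pure tensor_algebra_UNIV[OF that(2)])
  then show ?thesis
    using \<phi> by (auto simp: canonical_hom_def)
qed

lemma kernel_canonical_hom:
  assumes \<phi>: "canonical_hom H V \<phi>"
  shows "tensor_ideal (scale H) V {x \<in> tensor_algebra (scale H) V. \<phi> x = 0}"
proof -
  note l = canonical_homD(1)[OF \<phi>]
  have "module.subspace tscale {x \<in> tensor_algebra (scale H) V. \<phi> x = 0}"
    by (rule tens.subspaceI)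
      (simp_all add: linear_0[OF l] linearD(3,4)[OF l] tensor_algebra_0 tensor_algebra_add
        tensor_algebra_scale module.scale_zero_right[OF module_scale])
  then show ?thesis
    by (auto simp: tensor_ideal_def canonical_homD(3)[OF \<phi>] tensor_concat_closed[OF vector_space_scale]
        linear_0[OF linear_mult_left] linear_0[OF linear_mult_right])
qed

end

section \<open>Compatibility of the canonical maps with the action and with \<Psi>\<close>

context twist
begin

lemma qact_list_power:
  assumes "stable V" "xs \<in> lists V"
  shows "qact_list c xs h \<in> tensor_power sA (length xs) V"
  using assms(2)
proof (induction xs arbitrary: h)
  case Nil
  then show ?case
    by (simp add: tensor_power_def tens.span_scale tens.span_base)
next
  case (Cons a xs)
  have "module.subspace tscale (tensor_power sA n V)" for n
    by (simp add: tensor_power_def tens.subspace_span)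
  then show ?case
    using Cons assms(1)
    by (auto simp: stable_def intro!: ssum_in_subspace[OF tens.module_axioms]
        tensor_power_concat_cons[OF A.vector_space_scale])
qed

lemma qact_power:
  assumes "stable V" "x \<in> tensor_power sA n V"
  shows "qact c h x \<in> tensor_power sA n V"
  using assms(2)
proof (induction rule: tensor_power_induct)
  case subspace
  show ?case
    by (rule linear_subspace_vimage[OF linear_qact]) (simp add: tensor_power_def tens.subspace_span)
next
  case (tensor xs)
  then show ?case using qact_list_power[OF assms(1) tensor(1)] by (simp add: qact_tensor)
qed

text \<open>The recursion of the diagonal action is the module algebra axiom read in the tensor
  algebra.\<close>

lemma canonical_hom_dact:
  assumes V: "stable V" and \<phi>: "canonical_hom A V \<phi>" and x: "x \<in> tensor_algebra sA V"
  shows "\<phi> (dact h x) = act h (\<phi> x)"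
  using x
proof (rule tensor_algebra_eqI)
  note l = canonical_homD(1)[OF \<phi>]
  show "Vector_Spaces.linear tscale sA (\<lambda>x. \<phi> (dact h x))" "Vector_Spaces.linear tscale sA (\<lambda>x. act h (\<phi> x))"
    by (intro linear_comp[OF linear_qact l] linear_comp[OF l linear_act])+
  fix xs :: "'a list"
  assume "xs \<in> lists V"
  then show "\<phi> (dact h (tensor sA xs)) = act h (\<phi> (tensor sA xs))"
  proof (induction xs arbitrary: h)
    case Nil
    then show ?case by (simp add: qact_nil canonical_homD(2)[OF \<phi>] linearD(4)[OF l] act_one)
  next
    case (Cons a xs)
    have a: "act g a \<in> V" for g using V Cons.hyps by (auto simp: stable_def)
    have T: "tensor sA xs \<in> tensor_algebra sA V" using Cons.hyps by (simp add: tensor_in_algebra)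
    show ?case
      unfolding tensor_Cons[of a xs] dact_cons[OF A.tensor_in]
      by (simp add: ssum_map[OF l] canonical_hom_cons[OF \<phi> a qact_closed[OF V T]]
          canonical_hom_cons[OF \<phi> _ T] Cons act_amult)
  qed
qed

text \<open>The recursion of \<Psi> matches \<open>act_amult\<close> followed by
  \<open>amult_eq\<close>. The case \<open>h = unit H\<close> is the factorization of \<phi> through
  \<psi>; general \<open>h\<close> is needed for the induction.\<close>

lemma canonical_hom_\<Psi>:
  assumes V: "stable V" and \<phi>: "canonical_hom A V \<phi>" and \<psi>: "canonical_hom B V \<psi>"
    and x: "x \<in> tensor_algebra sA V"
  shows "\<psi> (\<Psi> h x) = act h (\<phi> x)"
  using x
proof (rule tensor_algebra_eqI)
  note l = canonical_homD(1)[OF \<phi>] and l' = canonical_homD(1)[OF \<psi>, simplified]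
  show "Vector_Spaces.linear tscale sA (\<lambda>x. \<psi> (\<Psi> h x))" "Vector_Spaces.linear tscale sA (\<lambda>x. act h (\<phi> x))"
    by (intro linear_comp[OF linear_qact l'] linear_comp[OF l linear_act])+
  fix xs :: "'a list"
  assume "xs \<in> lists V"
  then show "\<psi> (\<Psi> h (tensor sA xs)) = act h (\<phi> (tensor sA xs))"
  proof (induction xs arbitrary: h)
    case Nil
    then show ?case
      using canonical_homD(2)[OF \<psi>]
      by (simp add: qact_nil canonical_homD(2)[OF \<phi>] linearD(4)[OF l'] act_one)
  next
    case (Cons a xs)
    have a: "act g a \<in> V" for g using V Cons.hyps by (auto simp: stable_def)
    have T: "tensor sA xs \<in> tensor_algebra sA V" using Cons.hyps by (simp add: tensor_in_algebra)
    have *: "\<psi> (tensor sA [act g a] \<odot> \<Psi> k (tensor sA xs)) = act g a \<star> act k (\<phi> (tensor sA xs))" for g k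
      using canonical_hom_cons[OF \<psi> a, of "\<Psi> k (tensor sA xs)" g] qact_closed[OF V T]
      by (simp add: Cons)
    have "\<psi> (\<Psi> h (tensor sA (a # xs)))
      = S (\<Delta> h) (\<lambda>x y. S \<mu> (\<lambda>g k. act (g \<cdot> x) a \<star> act (k \<cdot> y) (\<phi> (tensor sA xs))))"
      by (simp only: tensor_Cons[of a xs] qact_cons[OF A.tensor_in] ssum_map[OF l'] *)
    also have "\<dots> = act h (\<phi> (tensor sA (a # xs)))"
      using Cons.hyps
      by (simp add: tensor_Cons[of a xs] canonical_hom_cons[OF \<phi> _ T] act_amult
          amult_eq[of "act _ a"] act_mult)
    finally show ?case .
  qed
qed

text \<open>The image is a subspace, so preimages of pure tensors suffice; they are built one entry
  at a time.\<close>

lemma \<Psi>_surj: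
  assumes V: "stable V" and x: "x \<in> tensor_algebra sA V"
  shows "\<exists>y\<in>tensor_algebra sA V. \<Psi> (unit H) y = x"
  using x
proof (induction rule: tensor_algebra_induct)
  case subspace
  note l = linear_qact[of \<mu> "unit H"]
  have "module.subspace tscale (\<Psi> (unit H) ` tensor_algebra sA V)"
    by (rule linear_subspace_image[OF l subspace_tensor_algebra])
  then show ?case by (simp add: image_def Bex_def eq_commute)
next
  case (tensor xs)
  then show ?case
  proof (induction xs)
    case Nil
    then show ?case by (intro bexI[of _ "tensor sA []"]) (simp_all add: qact_nil tensor_in_algebra)
  next
    case (Cons a xs)
    then obtain y where y: "y \<in> tensor_algebra sA V" "\<Psi> (unit H) y = tensor sA xs" by auto
    then have yT: "y \<in> TA" by (simp add: tensor_algebra_UNIV)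
    \<comment> \<open>From a preimage \<open>y\<close> of the tail, \<nu> acts on
      \<open>a \<otimes> y\<close> through the first entry and the diagonal action; the \<mu> from
      \<Psi> then meets \<nu> on its left and cancels.\<close>
    let ?z = "S \<nu> (\<lambda>u v. tensor sA [act u a] \<odot> dact v y)"
    have b: "bilin (scale H) tscale (\<lambda>g k. tensor sA [act g a] \<odot> \<Psi> k y)"
      by (intro bilin_act_tcat linear_qact_index qact_in yT)
    have "\<Psi> (unit H) ?z = S \<nu> (\<lambda>u v. S \<mu> (\<lambda>g k. tensor sA [act (g \<cdot> u) a] \<odot> \<Psi> (k \<cdot> v) y))"
      using yT by (simp add: ssum_map[OF linear_qact] \<Psi>_unit_cons \<Psi>_mult act_mult)
    also have "\<dots> = S \<mu> (\<lambda>g k. S \<nu> (\<lambda>u v. tensor sA [act (g \<cdot> u) a] \<odot> \<Psi> (k \<cdot> v) y))"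
      by (rule ssum_swap)
    also have "\<dots> = tensor sA (a # xs)"
      by (simp add: ssum_cocycle_inverse(1)[OF b] y(2) tcat_tensor)
    finally have "\<Psi> (unit H) ?z = tensor sA (a # xs)" .
    moreover have "?z \<in> tensor_algebra sA V"
      using Cons.hyps V
      by (intro ssum_tensor_algebra tcat_closed tensor_in_algebra qact_closed y(1)) (auto simp: stable_def)
    ultimately show ?case by blast
  qed
qed

end

section \<open>The twisted algebra as a quotient of the tensor algebra\<close>

theorem theorem2p1:
  fixes H :: "('k::field, 'h::ab_group_add) hopf_alg"
    and A :: "('k, 'a::ab_group_add) alg"
    and G :: "nat \<Rightarrow> 'a set"
    and R :: "('a, 'k) tensor set"
    and act :: "'h \<Rightarrow> 'a \<Rightarrow> 'a"
    and \<mu> :: "('h, 'k) tensor"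
  assumes "hopf_algebra H"
    and "quadratic_algebra A G R"
    and "module_algebra H A act"
    and "\<And>h i a. a \<in> G i \<Longrightarrow> act h a \<in> G i"
    and "two_cocycle H \<mu>"
    and "counital H \<mu>"
  shows "quadratic_algebra (drinfeld_twist H A act \<mu>) G {tensor_act H (scale A) act \<mu> r | r. r \<in> R}"
proof -
  interpret twist H \<mu> A act
    using assms(1,3,5,6) by unfold_locales
  define V where "V = G 1"
  let ?T = "tensor_algebra sA V"
  define R' where "R' = {tensor_act H sA act \<mu> r | r. r \<in> R}"
  define I where "I = generated_ideal sA V R'"
  note s = A.vector_space_scale
  have V: "stable V" using assms(4) by (simp add: stable_def V_def)
  have grading: "connected_graded A G" and finite: "locally_finite_dimensional A G"
    and R: "module.subspace tscale R" "R \<subseteq> tensor_power sA 2 V"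
    using assms(2) by (simp_all add: quadratic_algebra_def V_def)
  obtain \<phi> where \<phi>: "canonical_hom A V \<phi>" "\<phi> ` ?T = UNIV" "{x \<in> ?T. \<phi> x = 0} = generated_ideal sA V R"
    using assms(2) unfolding quadratic_algebra_def V_def by blast
  obtain \<psi> where \<psi>: "canonical_hom B V \<psi>" using B.canonical_hom_exists by blast
  have R_\<Psi>: "R' = \<Psi> (unit H) ` R"
  proof -
    have "R' = tensor_act H sA act \<mu> ` R" unfolding R'_def by blast
    also have "\<dots> = \<Psi> (unit H) ` R"
      using R(2) by (intro image_cong refl \<Psi>_tensor_act[symmetric]) blast
    finally show ?thesis .
  qed
  have R_power: "R' \<subseteq> tensor_power sA 2 V"
    unfolding R_\<Psi> using qact_power[OF V] R(2) by blast
  have R_subspace: "module.subspace tscale R'"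
    unfolding R_\<Psi> by (rule linear_subspace_image[OF linear_qact R(1)])
  have ideal: "tensor_ideal sA V I"
    using R_power tensor_power_subset unfolding I_def by (intro tensor_ideal_generated[OF s]) blast
  have R_ker: "r \<in> ?T" "\<phi> r = 0" if "r \<in> R" for r
    using that \<phi>(3) generated_ideal_superset[of R sA V] by blast+
  \<comment> \<open>Equivariance of \<phi> keeps \<open>dact h r\<close> in its kernel, the ideal
    generated by \<open>R\<close>, and the degree-two part of that ideal is
    \<open>R\<close>.\<close>
  have dact_R: "dact h r \<in> R" if "r \<in> R" for h r
  proof (rule generated_ideal_degree_two[OF s R])
    have "dact h r \<in> ?T" "\<phi> (dact h r) = 0"
      using R_ker[OF that] by (simp_all add: qact_closed[OF V] canonical_hom_dact[OF V \<phi>(1)]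
          linear_0[OF linear_act])
    then show "dact h r \<in> generated_ideal sA V R" using \<phi>(3) by blast
    show "dact h r \<in> tensor_power sA 2 V" using that R(2) by (intro qact_power[OF V]) blast
  qed
  \<comment> \<open>The condition ranges over all \<open>h\<close> because
    \<open>\<Psi>_concat\<close> evaluates \<Psi> on each factor at varying elements of
    \<open>H\<close>; for \<open>h = unit H\<close> alone the set would not visibly be an
    ideal.\<close>
  have \<Psi>_ideal: "generated_ideal sA V R \<subseteq> {x \<in> ?T. \<forall>h. \<Psi> h x \<in> I}" (is "_ \<subseteq> ?M")
  proof (rule generated_ideal_minimal)
    show "R \<subseteq> ?M"
    proof (intro subsetI CollectI conjI allI)
      fix r h assume r: "r \<in> R"
      then show "r \<in> ?T" by (rule R_ker)
      then have "\<Psi> h r = \<Psi> (unit H) (dact h r)"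
        using \<Psi>_mult[of r "unit H" h] by (simp add: tensor_algebra_UNIV)
      also have "\<dots> \<in> R'" unfolding R_\<Psi> using dact_R[OF r] by blast
      finally show "\<Psi> h r \<in> I" using generated_ideal_superset unfolding I_def by blast
    qed
    have sub: "module.subspace tscale I" using ideal by (simp add: tensor_ideal_def)
    note l = linear_qact[of \<mu>]
    have "module.subspace tscale ?M"
      by (intro tens.subspaceI)
        (simp_all add: linear_0[OF l] linearD(3,4)[OF l] tens.subspace_0[OF sub] tens.subspace_add[OF sub]
          tens.subspace_scale[OF sub] tensor_algebra_0 tensor_algebra_add tensor_algebra_scale)
    moreover have "x \<odot> y \<in> ?M \<and> y \<odot> x \<in> ?M" if x: "x \<in> ?M" and y: "y \<in> ?T" for x y
    proof -
      have T: "x \<in> TA" "y \<in> TA" using x y by (auto intro: tensor_algebra_UNIV)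
      have closed: "\<Psi> h x \<odot> \<Psi> k y \<in> I" "\<Psi> k y \<odot> \<Psi> h x \<in> I" for h k
        using ideal x qact_closed[OF V y] by (auto simp: tensor_ideal_def)
      have "\<Psi> h (x \<odot> y) \<in> I" "\<Psi> h (y \<odot> x) \<in> I" for h
        unfolding \<Psi>_concat[OF T] \<Psi>_concat[OF T(2,1)]
        by (intro ssum_in_subspace[OF tens.module_axioms sub] closed)+
      moreover have "x \<in> ?T" using x by simp
      ultimately show ?thesis using y by (simp add: tcat_closed)
    qed
    ultimately show "tensor_ideal sA V ?M" unfolding tensor_ideal_def by blast
  qed
  have kernel: "{x \<in> ?T. \<psi> x = 0} = I"
  proof
    have "\<psi> (\<Psi> (unit H) r) = 0" "\<Psi> (unit H) r \<in> ?T" if "r \<in> R" for r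
      using R_ker[OF that] by (simp_all add: canonical_hom_\<Psi>[OF V \<phi>(1) \<psi>] qact_closed[OF V])
    then show "I \<subseteq> {x \<in> ?T. \<psi> x = 0}"
      using B.kernel_canonical_hom[OF \<psi>] unfolding I_def by (intro generated_ideal_minimal) (auto simp: R_\<Psi>)
    show "{x \<in> ?T. \<psi> x = 0} \<subseteq> I"
    proof safe
      fix x assume x: "x \<in> ?T" "\<psi> x = 0"
      \<comment> \<open>A preimage under \<open>\<Psi> (unit H)\<close> carries the kernel of \<psi>
        back to the kernel of \<phi>, where the presentation of \<open>A\<close> applies.\<close>
      then obtain y where y: "y \<in> ?T" "\<Psi> (unit H) y = x" using \<Psi>_surj[OF V] by blast
      with x(2) have "\<phi> y = 0" using canonical_hom_\<Psi>[OF V \<phi>(1) \<psi> y(1), of "unit H"] by simp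
      with y(1) \<phi>(3) have "y \<in> generated_ideal sA V R" by blast
      with y(2) \<Psi>_ideal show "x \<in> I" by blast
    qed
  qed
  have surj: "\<psi> ` ?T = UNIV"
  proof (intro equalityI subset_UNIV subsetI)
    fix a
    obtain x where "x \<in> ?T" "a = \<phi> x" using \<phi>(2) by blast
    then show "a \<in> \<psi> ` ?T"
      using canonical_hom_\<Psi>[OF V \<phi>(1) \<psi>, of x "unit H"] qact_closed[OF V, of x \<mu> "unit H"]
      by (intro image_eqI[of _ _ "\<Psi> (unit H) x"]) simp_all
  qed
  \<comment> \<open>Degree preservation by \<open>H\<close> puts every summand of the twisted
    product into the same component as the original product.\<close>
  have "a \<star> b \<in> G (i + j)" if "a \<in> G i" "b \<in> G j" for a b i j
    unfolding tmult_def using grading assms(4) that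
    by (intro ssum_in_subspace[OF A.module_scale]) (auto simp: connected_graded_def)
  then have "connected_graded B G" using grading by (simp add: connected_graded_def)
  moreover have "locally_finite_dimensional B G"
    using finite by (simp add: locally_finite_dimensional_def)
  ultimately show ?thesis
    unfolding quadratic_algebra_def drinfeld_twist_simps V_def[symmetric] R'_def[symmetric]
    by (intro conjI exI[of _ \<psi>] B.k_algebra R_subspace R_power \<psi> surj kernel[unfolded I_def])
qed

end
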